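(* Let $n\ge 2$, let $K$ be an infinite field contained in a local field $L$, and let $\overline{L}$ be an algebraic closure of $L$. Let $r\ge 1$ and let $w\in \mathrm{GL}_n(\overline{L})\ast \mathbf{F}_r$ be a (reduced) word of length $l\ge 2$ none of whose critical constants is Tomanov-small with respect to $\mathbf{G}=\mathrm{SL}_n$, i.e. $\mathbf{\Lambda}(\overline{L})\cap I(w)=\varnothing$. Then $\dim\bigl(w(\mathrm{SL}_n(K)^r)\bigr)\ge 2(n-1)$.
   Context: Words: $\mathbf{F}_r=\langle x_1,\dots,x_r\rangle$ is the free group of rank $r$. A word with constants in a group $C$ is $w=c_0x_{i(1)}^{\varepsilon(1)}c_1\cdots c_{l-1}x_{i(l)}^{\varepsilon(l)}c_l\in C\ast\mathbf{F}_r$ with $c_j\in C$, $\varepsilon(j)\in\{\pm1\}$, taken reduced: if $i(j)=i(j+1)$ and $\varepsilon(j)=-\varepsilon(j+1)$ then $c_j\ne 1$. Its length is $l$. An index $j\in\{1,\dots,l-1\}$ is critical if $i(j)=i(j+1)$ and $\varepsilon(j)=-\varepsilon(j+1)$; then $c_j$ is a critical constant, and $I(w)$ denotes the set of critical constants. For a subgroup $G\le C$, $w(G^r)\subseteq C$ is the image of the word map $(g_1,\dots,g_r)\mapsto w(g_1,\dots,g_r)$. Dimension: for a subset $T$ of the $n\times n$ matrices $\mathbf{M}_n(\overline{L})$, $\dim(T)$ is the Krull dimension of its Zariski closure in $\mathbf{M}_n(\overline{L})$. Tomanov-small constants: let $\mathbf{G}\le\mathrm{GL}(\mathbf{V})$,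 $\mathbf{V}=\mathbf{A}^n$ (here $\mathbf{G}=\mathrm{SL}_n$ with its natural action), let $\mathbf{T}$ be a maximal torus of $\mathbf{G}$, and let $e_1,\dots,e_n$ be a basis of weight vectors of $\mathbf{V}(\overline{L})$ for $\mathbf{T}$ with $e_1$ a highest weight vector and $e_n$ a lowest weight vector; $e_1^\ast,\dots,e_n^\ast$ is the dual basis. Groups act from the right, and $c^g=g^{-1}cg$. Then $\mathbf{\Lambda}(\overline{L})=\{c\in\mathrm{GL}(\mathbf{V}(\overline{L})) : (e_1.c^g).e_n^\ast=0\text{ for all }g\in\mathbf{G}(\overline{L})\}$, where $v.e_n^\ast$ is the value of the functional $e_n^\ast$ at $v$. *)

theory Defs
  imports
    "HOL-Analysis.Analysis"
    "HOL-Algebra.Algebraic_Closure_Type"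
    "HOL-Algebra.Solvable_Groups"
begin

text \<open>All fields are subfields of one ambient field type, which plays the role of the algebraic
  closure of \<open>L\<close>.\<close>

section \<open>Local fields\<close>

text \<open>A local field is a non-discrete, locally compact, Hausdorff topological field. Archimedean
  fields are included. Continuity of negation follows from that of multiplication.\<close>

definition local_field :: "'a::field set \<Rightarrow> 'a topology \<Rightarrow> bool" where
  "local_field L \<tau> \<longleftrightarrow>
     subfield L (ring_of_type_algebra :: 'a ring) \<and>
     topspace \<tau> = L \<and> Hausdorff_space \<tau> \<and> locally_compact_space \<tau> \<and>
     \<tau> \<noteq> discrete_topology L \<and>
     continuous_map (prod_topology \<tau> \<tau>) \<tau> (\<lambda>(x, y). x + y) \<and>
     continuous_map (prod_topology \<tau> \<tau>) \<tau> (\<lambda>(x, y). x * y) \<and>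
     continuous_map (subtopology \<tau> (L - {0})) \<tau> inverse"


section \<open>Zariski topology and Krull dimension\<close>

inductive polynomial_map :: "('a::field^'n^'m \<Rightarrow> 'a) \<Rightarrow> bool" where
  const: "polynomial_map (\<lambda>A. c)"
| entry: "polynomial_map (\<lambda>A. A $ i $ j)"
| add: "polynomial_map p \<Longrightarrow> polynomial_map q \<Longrightarrow> polynomial_map (\<lambda>A. p A + q A)"
| mult: "polynomial_map p \<Longrightarrow> polynomial_map q \<Longrightarrow> polynomial_map (\<lambda>A. p A * q A)"

definition zero_locus :: "('a::field^'n^'m \<Rightarrow> 'a) set \<Rightarrow> ('a^'n^'m) set" where
  "zero_locus F = {A. \<forall>f\<in>F. f A = 0}"

definition zariski :: "('a::field^'n^'m) topology" where
  "zariski = topology (\<lambda>U. \<exists>F. F \<subseteq> Collect polynomial_map \<and> U = - zero_locus F)"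

lemma openin_zariski:
  fixes U :: "('a::field^'n^'m) set"
  shows "openin zariski U \<longleftrightarrow> (\<exists>F. F \<subseteq> Collect polynomial_map \<and> U = - zero_locus F)"
proof -
  let ?P = "\<lambda>U :: ('a^'n^'m) set. \<exists>F. F \<subseteq> Collect polynomial_map \<and> U = - zero_locus F"
  have "istopology ?P"
    unfolding istopology_def
  proof (intro conjI allI impI)
    fix S T :: "('a^'n^'m) set"
    assume "?P S" "?P T"
    then obtain F G where FG: "F \<subseteq> Collect polynomial_map" "S = - zero_locus F"
      "G \<subseteq> Collect polynomial_map" "T = - zero_locus G" by blast
    let ?H = "{\<lambda>A. f A * g A | f g. f \<in> F \<and> g \<in> G}"
    have "?H \<subseteq> Collect polynomial_map"
      using FG(1,3) by (auto intro: polynomial_map.mult)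
    moreover have "S \<inter> T = - zero_locus ?H"
    proof -
      have "A \<in> S \<inter> T \<longleftrightarrow> (\<exists>f\<in>F. \<exists>g\<in>G. f A * g A \<noteq> 0)" for A
        using FG(2,4) by (auto simp: zero_locus_def)
      then show ?thesis by (fastforce simp: zero_locus_def)
    qed
    ultimately show "?P (S \<inter> T)" by blast
  next
    fix \<K> :: "('a^'n^'m) set set"
    assume "\<forall>U\<in>\<K>. ?P U"
    then obtain F where F: "\<And>U. U \<in> \<K> \<Longrightarrow> F U \<subseteq> Collect polynomial_map \<and> U = - zero_locus (F U)"
      by metis
    have "\<Union>\<K> = - zero_locus (\<Union>U\<in>\<K>. F U)"
    proof (rule Set.set_eqI)
      fix A
      have "A \<in> U \<longleftrightarrow> (\<exists>f\<in>F U. f A \<noteq> 0)" if "U \<in> \<K>" for U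
        using F[OF that] by (auto simp: zero_locus_def)
      then show "A \<in> \<Union>\<K> \<longleftrightarrow> A \<in> - zero_locus (\<Union>U\<in>\<K>. F U)"
        by (auto simp: zero_locus_def)
    qed
    moreover have "(\<Union>U\<in>\<K>. F U) \<subseteq> Collect polynomial_map" using F by blast
    ultimately show "?P (\<Union>\<K>)" by blast
  qed
  then show ?thesis by (simp add: zariski_def topology_inverse')
qed

lemma topspace_zariski [simp]: "topspace (zariski :: ('a::field^'n^'m) topology) = UNIV"
proof -
  have "openin zariski (- zero_locus {\<lambda>A :: 'a^'n^'m. 1})"
    unfolding openin_zariski by (blast intro: polynomial_map.const)
  then have "openin zariski (UNIV :: ('a^'n^'m) set)" by (simp add: zero_locus_def)
  then show ?thesis using openin_subset by blast
qed

lemma closedin_zariski: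
  "closedin zariski Z \<longleftrightarrow> (\<exists>F. F \<subseteq> Collect polynomial_map \<and> Z = zero_locus F)"
  by (auto simp: closedin_def openin_zariski Compl_eq_Diff_UNIV[symmetric])

definition irreducible_closedin :: "'b topology \<Rightarrow> 'b set \<Rightarrow> bool" where
  "irreducible_closedin \<tau> Z \<longleftrightarrow> closedin \<tau> Z \<and> Z \<noteq> {} \<and>
     (\<forall>A B. closedin \<tau> A \<and> closedin \<tau> B \<and> Z = A \<union> B \<longrightarrow> Z = A \<or> Z = B)"

text \<open>The supremum of the lengths \<open>d\<close> of chains \<open>Z\<^sub>0 \<subset> \<dots> \<subset> Z\<^sub>d\<close> of irreducible closed subsets;
  the empty space gets dimension 0.\<close>

definition krull_dim :: "'b topology \<Rightarrow> enat" where
  "krull_dim \<tau> = Sup {enat d | d. \<exists>Z :: nat \<Rightarrow> 'b set.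
     (\<forall>i\<le>d. irreducible_closedin \<tau> (Z i)) \<and> (\<forall>i<d. Z i \<subset> Z (Suc i))}"

definition zariski_dim :: "('a::field^'n^'m) set \<Rightarrow> enat" where
  "zariski_dim S = krull_dim (subtopology zariski (zariski closure_of S))"


section \<open>Linear groups\<close>

definition GL_group :: "('a::field^'n^'n) monoid" where
  "GL_group = \<lparr>carrier = {A. invertible A}, monoid.mult = (**), one = mat 1\<rparr>"

lemma group_GL_group: "group (GL_group :: ('a::field^'n^'n) monoid)"
proof (rule groupI)
  fix A :: "'a^'n^'n"
  assume "A \<in> carrier GL_group"
  then obtain B where "A ** B = mat 1" "B ** A = mat 1"
    by (auto simp: GL_group_def invertible_def)
  then show "\<exists>B\<in>carrier GL_group. B \<otimes>\<^bsub>GL_group\<^esub> A = \<one>\<^bsub>GL_group\<^esub>"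
    by (auto simp: GL_group_def invertible_def)
qed (auto simp: GL_group_def invertible_mult matrix_mul_assoc intro: invertible_def[THEN iffD2])

definition SL :: "'a::field set \<Rightarrow> ('a^'n^'n) set" where
  "SL K = {A. (\<forall>i j. A $ i $ j \<in> K) \<and> det A = 1}"

definition closed_subgroup :: "('a::field^'n^'n) set \<Rightarrow> bool" where
  "closed_subgroup H \<longleftrightarrow>
     subgroup H GL_group \<and> closedin (subtopology zariski (carrier GL_group)) H"

definition diagonalizable :: "('a::field^'n^'n) set \<Rightarrow> bool" where
  "diagonalizable H \<longleftrightarrow>
     (\<exists>P :: 'a^'n^'n. invertible P \<and> (\<forall>A\<in>H. \<forall>i j. i \<noteq> j \<longrightarrow> (P ** A ** matrix_inv P) $ i $ j = 0))"

text \<open>The following notions are meant over an algebraically closed field, an algebraic group being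
  identified with its group of rational points. A torus is a closed connected diagonalizable
  group.\<close>

definition torus :: "('a::field^'n^'n) set \<Rightarrow> bool" where
  "torus T \<longleftrightarrow> closed_subgroup T \<and> connectedin zariski T \<and> diagonalizable T"

definition maximal_torus :: "('a::field^'n^'n) set \<Rightarrow> ('a^'n^'n) set \<Rightarrow> bool" where
  "maximal_torus G T \<longleftrightarrow> torus T \<and> T \<subseteq> G \<and> (\<forall>T'. torus T' \<and> T \<subseteq> T' \<and> T' \<subseteq> G \<longrightarrow> T' = T)"

definition connected_solvable :: "('a::field^'n^'n) set \<Rightarrow> bool" where
  "connected_solvable B \<longleftrightarrow>
     closed_subgroup B \<and> connectedin zariski B \<and> solvable (GL_group\<lparr>carrier := B\<rparr>)"

definition borel_subgroup :: "('a::field^'n^'n) set \<Rightarrow> ('a^'n^'n) set \<Rightarrow> bool" where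
  "borel_subgroup G B \<longleftrightarrow> connected_solvable B \<and> B \<subseteq> G \<and>
     (\<forall>B'. connected_solvable B' \<and> B \<subseteq> B' \<and> B' \<subseteq> G \<longrightarrow> B' = B)"


section \<open>Weight vectors and Tomanov-small elements\<close>

text \<open>Groups act on row vectors from the right, by \<open>v v* A\<close>.\<close>

definition weight_vector :: "('a::field^'n^'n) set \<Rightarrow> 'a^'n \<Rightarrow> bool" where
  "weight_vector T v \<longleftrightarrow> v \<noteq> 0 \<and> (\<exists>\<psi>. \<forall>t\<in>T. v v* t = \<psi> t *s v)"

definition weight_basis :: "('a::field^'n^'n) set \<Rightarrow> (nat \<Rightarrow> 'a^'n) \<Rightarrow> bool" where
  "weight_basis T e \<longleftrightarrow> inj_on e {1..CARD('n)} \<and> vec.independent (e ` {1..CARD('n)}) \<and>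
     vec.span (e ` {1..CARD('n)}) = UNIV \<and> (\<forall>i\<in>{1..CARD('n)}. weight_vector T (e i))"

text \<open>For an irreducible module, \<open>v\<close> is a highest and \<open>u\<close> a lowest weight vector, with respect to
  some choice of positive roots for \<open>T\<close>: their lines are stable under a Borel subgroup containing
  \<open>T\<close> and under the opposite one, respectively. Opposite means that the intersection is \<open>T\<close>.\<close>

definition highest_lowest ::
    "('a::field^'n^'n) set \<Rightarrow> ('a^'n^'n) set \<Rightarrow> 'a^'n \<Rightarrow> 'a^'n \<Rightarrow> bool" where
  "highest_lowest G T v u \<longleftrightarrow> (\<exists>B B'. borel_subgroup G B \<and> borel_subgroup G B' \<and> B \<inter> B' = T \<and>
     weight_vector B v \<and> weight_vector B' u)"

definition dual_basis :: "(nat \<Rightarrow> 'a::field^'n) \<Rightarrow> nat \<Rightarrow> 'a^'n \<Rightarrow> 'a" where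
  "dual_basis e i v = vec.representation (e ` {1..CARD('n)}) v (e i)"

definition tomanov_small ::
    "('a::field^'n^'n) set \<Rightarrow> (nat \<Rightarrow> 'a^'n) \<Rightarrow> ('a^'n^'n) set" where
  "tomanov_small G e = {c \<in> carrier GL_group. \<forall>g\<in>G.
     dual_basis e CARD('n) (e 1 v* (inv\<^bsub>GL_group\<^esub> g \<otimes>\<^bsub>GL_group\<^esub> c \<otimes>\<^bsub>GL_group\<^esub> g)) = 0}"


section \<open>Words with constants\<close>

text \<open>The pair of \<open>c\<^sub>0\<close> and \<open>[(i\<^sub>1, \<epsilon>\<^sub>1, c\<^sub>1), \<dots>, (i\<^sub>l, \<epsilon>\<^sub>l, c\<^sub>l)]\<close> stands for
  \<open>c\<^sub>0 x\<^bsub>i\<^sub>1\<^esub>\<^bsup>\<epsilon>\<^sub>1\<^esup> c\<^sub>1 \<dots> x\<^bsub>i\<^sub>l\<^esub>\<^bsup>\<epsilon>\<^sub>l\<^esup> c\<^sub>l\<close>. By the normal form theorem for free products,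
  the reduced ones represent the elements of the free product of \<open>C\<close> and the free group
  uniquely.\<close>

type_synonym 'c cword = "'c \<times> (nat \<times> int \<times> 'c) list"

definition word_length :: "'c cword \<Rightarrow> nat" where
  "word_length w = length (snd w)"

definition word_var :: "'c cword \<Rightarrow> nat \<Rightarrow> nat" where
  "word_var w j = fst (snd w ! (j - 1))"

definition word_exp :: "'c cword \<Rightarrow> nat \<Rightarrow> int" where
  "word_exp w j = fst (snd (snd w ! (j - 1)))"

definition word_const :: "'c cword \<Rightarrow> nat \<Rightarrow> 'c" where
  "word_const w j = (if j = 0 then fst w else snd (snd (snd w ! (j - 1))))"

definition critical :: "'c cword \<Rightarrow> nat \<Rightarrow> bool" where
  "critical w j \<longleftrightarrow> 1 \<le> j \<and> j < word_length w \<and>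
     word_var w j = word_var w (j + 1) \<and> word_exp w j = - word_exp w (j + 1)"

definition critical_constants :: "'c cword \<Rightarrow> 'c set" where
  "critical_constants w = {word_const w j | j. critical w j}"

definition reduced_word :: "('c, 'b) monoid_scheme \<Rightarrow> nat \<Rightarrow> 'c cword \<Rightarrow> bool" where
  "reduced_word C r w \<longleftrightarrow>
     (\<forall>j\<le>word_length w. word_const w j \<in> carrier C) \<and>
     (\<forall>j\<in>{1..word_length w}. word_var w j \<in> {1..r} \<and> word_exp w j \<in> {1, -1}) \<and>
     (\<forall>j. critical w j \<longrightarrow> word_const w j \<noteq> \<one>\<^bsub>C\<^esub>)"

definition word_value :: "('c, 'b) monoid_scheme \<Rightarrow> (nat \<Rightarrow> 'c) \<Rightarrow> 'c cword \<Rightarrow> 'c" where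
  "word_value C g w =
     foldl (\<lambda>a (i, \<epsilon>, c). a \<otimes>\<^bsub>C\<^esub> (g i [^]\<^bsub>C\<^esub> \<epsilon>) \<otimes>\<^bsub>C\<^esub> c) (fst w) (snd w)"

definition word_image :: "('c, 'b) monoid_scheme \<Rightarrow> 'c set \<Rightarrow> nat \<Rightarrow> 'c cword \<Rightarrow> 'c set" where
  "word_image C G r w = {word_value C g w | g. \<forall>i\<in>{1..r}. g i \<in> G}"

end

theory Submission
  imports Defs
begin

text \<open>Scalar matrices are Tomanov-small, so no critical constant is scalar. Let \<open>E\<close> be the matrix unit at
  \<open>(k0, k1)\<close>, and substitute \<open>h\<^bsub>i,1\<^esub> (1 + t E) h\<^bsub>i,-1\<^esub>\<^sup>-\<^sup>1\<close> for \<open>x\<^sub>i\<close>. The coefficient of the value of \<open>w\<close> at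
  \<open>t\<^sup>l\<close> is a scalar times \<open>c\<^sub>0 p q c\<^sub>l\<close> for a column \<open>p\<close> and a row \<open>q\<close>, and the scalar is generically
  nonzero since the critical constants are not scalar. The matrices \<open>p q\<close> have rank one, and up to
  scaling they depend on \<open>2 n - 3\<close> free parameters even if \<open>q p = 0\<close> is forced, as in \<open>x c x\<^sup>-\<^sup>1\<close>. With \<open>t\<close>
  there are \<open>2 n - 2\<close> parameters. Releasing them one at a time gives an ascending chain of closures
  of images of affine spaces, which are irreducible. The inclusions are strict: \<open>i + 1\<close> polynomials in
  \<open>i\<close> variables are algebraically dependent, whereas the entries that read off \<open>i + 1\<close> released
  parameters have algebraically independent leading forms.\<close>

no_notation fps_nth (infixl \<open>$\<close> 75)
hide_const (open) Polynomials.degree up_ring.coeff up_ring.monom module.smult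

section \<open>Polynomial functions\<close>

lemma poly_eq_0_if_infinite_roots:
  fixes P :: "'a::idom poly"
  assumes "infinite K" and "\<And>x. x \<in> K \<Longrightarrow> poly P x = 0"
  shows "P = 0"
proof (rule ccontr)
  assume "P \<noteq> 0"
  then have "finite {x. poly P x = 0}" by (rule poly_roots_finite)
  moreover have "K \<subseteq> {x. poly P x = 0}" using assms(2) by blast
  ultimately show False using assms(1) finite_subset by blast
qed

text \<open>Polynomials in arbitrarily many variables are kept as functions, with clauses parallel
  to those of \<open>polynomial_map\<close>, so that composing the two kinds is a plain
  induction.\<close>

inductive_set polyfun :: "(('v \<Rightarrow> 'a::comm_ring_1) \<Rightarrow> 'a) set" where
  polyfun_const: "(\<lambda>x. c) \<in> polyfun"
| polyfun_var: "(\<lambda>x. x v) \<in> polyfun"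
| polyfun_add: "p \<in> polyfun \<Longrightarrow> q \<in> polyfun \<Longrightarrow> (\<lambda>x. p x + q x) \<in> polyfun"
| polyfun_mult: "p \<in> polyfun \<Longrightarrow> q \<in> polyfun \<Longrightarrow> (\<lambda>x. p x * q x) \<in> polyfun"

lemma polyfun_uminus: "p \<in> polyfun \<Longrightarrow> (\<lambda>x. - p x) \<in> polyfun"
  using polyfun_mult[OF polyfun_const[of "-1"]] by force

lemma polyfun_diff: "p \<in> polyfun \<Longrightarrow> q \<in> polyfun \<Longrightarrow> (\<lambda>x. p x - q x) \<in> polyfun"
  using polyfun_add[OF _ polyfun_uminus] by force

lemma polyfun_sum: "(\<And>i. i \<in> A \<Longrightarrow> p i \<in> polyfun) \<Longrightarrow> (\<lambda>x. \<Sum>i\<in>A. p i x) \<in> polyfun"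
  by (induction A rule: infinite_finite_induct) (auto intro: polyfun_const polyfun_add)

lemma polyfun_prod: "(\<And>i. i \<in> A \<Longrightarrow> p i \<in> polyfun) \<Longrightarrow> (\<lambda>x. \<Prod>i\<in>A. p i x) \<in> polyfun"
  by (induction A rule: infinite_finite_induct) (auto intro: polyfun_const polyfun_mult)

lemma polyfun_power: "p \<in> polyfun \<Longrightarrow> (\<lambda>x. p x ^ k) \<in> polyfun"
  by (induction k) (auto intro: polyfun_const polyfun_mult)

lemmas polyfun_intros = polyfun_const polyfun_var polyfun_add polyfun_mult polyfun_uminus
  polyfun_diff polyfun_sum polyfun_prod polyfun_power

lemma polyfun_polynomial_map:
  assumes "polynomial_map F" and "\<And>i j. (\<lambda>x. M x $ i $ j) \<in> polyfun"
  shows "(\<lambda>x. F (M x)) \<in> polyfun"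
  using assms(1) by induction (auto intro: polyfun_intros assms(2))

lemma polynomial_map_sum:
  "(\<And>i. i \<in> A \<Longrightarrow> polynomial_map (p i)) \<Longrightarrow> polynomial_map (\<lambda>x. \<Sum>i\<in>A. p i x)"
  by (induction A rule: infinite_finite_induct) (auto intro: polynomial_map.intros)

lemma polynomial_map_prod:
  "(\<And>i. i \<in> A \<Longrightarrow> polynomial_map (p i)) \<Longrightarrow> polynomial_map (\<lambda>x. \<Prod>i\<in>A. p i x)"
  by (induction A rule: infinite_finite_induct) (auto intro: polynomial_map.intros)

lemma polynomial_map_power: "polynomial_map p \<Longrightarrow> polynomial_map (\<lambda>x. p x ^ k)"
  by (induction k) (auto intro: polynomial_map.intros)

lemma polyfun_on_line:
  assumes "p \<in> polyfun"
  shows "\<exists>P. \<forall>u. poly P u = p (\<lambda>v. x v + u * (y v - x v))"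
  using assms
proof induction
  case (polyfun_const c)
  show ?case by (rule exI[of _ "[:c:]"]) simp
next
  case (polyfun_var v)
  show ?case by (rule exI[of _ "[:x v, y v - x v:]"]) simp
next
  case (polyfun_add p q)
  then show ?case by (metis poly_add)
next
  case (polyfun_mult p q)
  then show ?case by (metis poly_mult)
qed

section \<open>Points with coordinates in an infinite subring\<close>

locale infinite_subring =
  fixes K :: "'a::field set"
  assumes infinite_K: "infinite K"
    and zero_mem: "0 \<in> K" and one_mem: "1 \<in> K"
    and uminus_mem: "a \<in> K \<Longrightarrow> - a \<in> K"
    and add_mem: "a \<in> K \<Longrightarrow> b \<in> K \<Longrightarrow> a + b \<in> K"
    and mult_mem: "a \<in> K \<Longrightarrow> b \<in> K \<Longrightarrow> a * b \<in> K"
begin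

lemma diff_mem: "a \<in> K \<Longrightarrow> b \<in> K \<Longrightarrow> a - b \<in> K"
  using add_mem[OF _ uminus_mem] by fastforce

lemma sum_mem: "(\<And>i. i \<in> A \<Longrightarrow> f i \<in> K) \<Longrightarrow> sum f A \<in> K"
  by (induction A rule: infinite_finite_induct) (auto intro: zero_mem add_mem)

text \<open>The \<open>K\<close>-points of the affine space with coordinates in \<open>I\<close>,
  the other coordinates being frozen at \<open>\<sigma>\<close>. Enlarging \<open>I\<close> releases
  parameters.\<close>

definition slice :: "'v set \<Rightarrow> ('v \<Rightarrow> 'a) \<Rightarrow> ('v \<Rightarrow> 'a) set" where
  "slice I \<sigma> = {x. (\<forall>v\<in>I. x v \<in> K) \<and> (\<forall>v. v \<notin> I \<longrightarrow> x v = \<sigma> v)}"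

lemma slice_mono: "range \<sigma> \<subseteq> K \<Longrightarrow> I \<subseteq> J \<Longrightarrow> slice I \<sigma> \<subseteq> slice J \<sigma>"
  unfolding slice_def by safe (metis rangeI subsetD, blast)

lemma base_mem_slice: "range \<sigma> \<subseteq> K \<Longrightarrow> \<sigma> \<in> slice I \<sigma>"
  by (auto simp: slice_def)

lemma slice_upd: "x \<in> slice I \<sigma> \<Longrightarrow> v \<in> I \<Longrightarrow> u \<in> K \<Longrightarrow> x(v := u) \<in> slice I \<sigma>"
  by (auto simp: slice_def)

text \<open>Restriction to the line through two points reduces this to polynomials in one variable.\<close>

lemma slice_common_nonzero:
  assumes p: "p \<in> polyfun" and q: "q \<in> polyfun"
    and x: "x \<in> slice I \<sigma>" "p x \<noteq> 0" and y: "y \<in> slice I \<sigma>" "q y \<noteq> 0"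
  shows "\<exists>z\<in>slice I \<sigma>. p z \<noteq> 0 \<and> q z \<noteq> 0"
proof -
  let ?l = "\<lambda>u v. x v + u * (y v - x v)"
  obtain P Q where P: "\<And>u. poly P u = p (?l u)" and Q: "\<And>u. poly Q u = q (?l u)"
    using polyfun_on_line[OF p, of x y] polyfun_on_line[OF q, of x y] by metis
  have "P \<noteq> 0" using P[of 0] x(2) by auto
  moreover have "Q \<noteq> 0" using Q[of 1] y(2) by auto
  ultimately have "P * Q \<noteq> 0" by simp
  then obtain u where u: "u \<in> K" "poly (P * Q) u \<noteq> 0"
    using poly_eq_0_if_infinite_roots[OF infinite_K] by blast
  have "?l u \<in> slice I \<sigma>"
    using x(1) y(1) u(1) by (auto simp: slice_def intro!: add_mem mult_mem diff_mem)
  then show ?thesis using u(2) P Q by auto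
qed

lemma slice_common_nonzero_prod:
  assumes "finite A" and "\<And>i. i \<in> A \<Longrightarrow> p i \<in> polyfun" and "range \<sigma> \<subseteq> K"
    and "\<And>i. i \<in> A \<Longrightarrow> \<exists>x\<in>slice I \<sigma>. p i x \<noteq> 0"
  shows "\<exists>x\<in>slice I \<sigma>. (\<Prod>i\<in>A. p i x) \<noteq> 0"
  using assms(1,2,4)
proof (induction rule: finite_induct)
  case empty
  then show ?case using base_mem_slice[OF assms(3)] by auto
next
  case (insert i A)
  obtain x y where "x \<in> slice I \<sigma>" "p i x \<noteq> 0" "y \<in> slice I \<sigma>" "(\<Prod>i\<in>A. p i y) \<noteq> 0"
    using insert by (metis insertCI)
  then have "\<exists>z\<in>slice I \<sigma>. p i z \<noteq> 0 \<and> (\<Prod>i\<in>A. p i z) \<noteq> 0"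
    using insert.prems by (intro slice_common_nonzero[of "p i"]) (auto intro: polyfun_prod)
  then show ?case using insert.hyps by auto
qed

end


section \<open>Algebraic dependence by counting\<close>

definition monom_fun :: "'v set \<Rightarrow> ('v \<Rightarrow> nat) \<Rightarrow> ('v \<Rightarrow> 'a::comm_ring_1) \<Rightarrow> 'a" where
  "monom_fun I \<alpha> x = (\<Prod>v\<in>I. x v ^ \<alpha> v)"

text \<open>Each exponent is bounded separately, rather than the total degree, so that the number of
  monomials is a pure power. Extensionality gives each monomial a single exponent.\<close>

definition exponents :: "'v set \<Rightarrow> nat \<Rightarrow> ('v \<Rightarrow> nat) set" where
  "exponents I D = I \<rightarrow>\<^sub>E {..D}"

lemma finite_exponents: "finite I \<Longrightarrow> finite (exponents I D)"
  by (simp add: exponents_def finite_PiE)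

lemma card_exponents: "finite I \<Longrightarrow> card (exponents I D) = Suc D ^ card I"
  by (simp add: exponents_def card_PiE)

inductive_set bounded_polys :: "'v set \<Rightarrow> nat \<Rightarrow> (('v \<Rightarrow> 'a::comm_ring_1) \<Rightarrow> 'a) set"
  for I :: "'v set" and D :: nat where
  mono: "\<alpha> \<in> exponents I D \<Longrightarrow> (\<lambda>x. a * monom_fun I \<alpha> x) \<in> bounded_polys I D"
| add: "p \<in> bounded_polys I D \<Longrightarrow> q \<in> bounded_polys I D \<Longrightarrow> (\<lambda>x. p x + q x) \<in> bounded_polys I D"

lemma bounded_polys_mono: "p \<in> bounded_polys I D \<Longrightarrow> D \<le> D' \<Longrightarrow> p \<in> bounded_polys I D'"
proof (induction rule: bounded_polys.induct)
  case (mono \<alpha> a)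
  then show ?case by (intro bounded_polys.mono) (auto simp: exponents_def PiE_iff intro: order_trans)
qed (rule bounded_polys.add)

lemma bounded_polys_const: "(\<lambda>x. a) \<in> bounded_polys I D"
proof -
  have "(\<lambda>x. a * monom_fun I (restrict (\<lambda>v. 0) I) x) \<in> bounded_polys I D"
    by (intro bounded_polys.mono) (auto simp: exponents_def)
  then show ?thesis by (simp add: monom_fun_def)
qed

lemma bounded_polys_var:
  assumes "finite I" "v \<in> I"
  shows "(\<lambda>x. x v :: 'a::comm_ring_1) \<in> bounded_polys I 1"
proof -
  let ?\<alpha> = "restrict (\<lambda>w. if w = v then 1 else 0) I"
  have eq: "monom_fun I ?\<alpha> x = x v" for x :: "_ \<Rightarrow> 'a"
  proof -
    have "monom_fun I ?\<alpha> x = (\<Prod>w\<in>I. if w = v then x w else 1)"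
      unfolding monom_fun_def by (intro prod.cong) auto
    then show ?thesis using assms by (simp add: prod.delta)
  qed

  have "(\<lambda>x. 1 * monom_fun I ?\<alpha> x :: 'a) \<in> bounded_polys I 1"
    by (intro bounded_polys.mono) (auto simp: exponents_def)
  then show ?thesis by (simp only: eq mult_1)
qed

lemma bounded_polys_mult:
  assumes "p \<in> bounded_polys I D" "q \<in> bounded_polys I E"
  shows "(\<lambda>x. p x * q x) \<in> bounded_polys I (D + E)"
  using assms(1)
proof induction
  case (mono \<alpha> a)
  show ?case using assms(2)
  proof induction
    case (mono \<beta> b)
    let ?\<gamma> = "restrict (\<lambda>v. \<alpha> v + \<beta> v) I"
    have "(\<lambda>x. (a * b) * monom_fun I ?\<gamma> x) \<in> bounded_polys I (D + E)"
      using mono \<open>\<alpha> \<in> exponents I D\<close> by (intro bounded_polys.mono) (auto simp: exponents_def PiE_iff add_mono)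
    moreover have "monom_fun I ?\<gamma> x = monom_fun I \<alpha> x * monom_fun I \<beta> x" for x :: "'a \<Rightarrow> 'b"
      by (simp add: monom_fun_def power_add prod.distrib)
    ultimately show ?case by (simp add: mult_ac)
  next
    case (add p q)
    then show ?case by (simp add: distrib_left bounded_polys.add)
  qed
next
  case (add p p')
  then show ?case by (simp add: distrib_right bounded_polys.add)
qed

lemma bounded_polys_power: "p \<in> bounded_polys I D \<Longrightarrow> (\<lambda>x. p x ^ k) \<in> bounded_polys I (D * k)"
proof (induction k)
  case (Suc k)
  then show ?case using bounded_polys_mult[of p I D "\<lambda>x. p x ^ k" "D * k"] by simp
qed (simp add: bounded_polys_const)

lemma bounded_polys_prod:
  assumes "finite A" "\<And>i. i \<in> A \<Longrightarrow> p i \<in> bounded_polys I D"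
  shows "(\<lambda>x. \<Prod>i\<in>A. p i x) \<in> bounded_polys I (D * card A)"
  using assms
proof (induction rule: finite_induct)
  case (insert i A)
  then have "(\<lambda>x. p i x * (\<Prod>i\<in>A. p i x)) \<in> bounded_polys I (D + D * card A)"
    by (intro bounded_polys_mult) auto
  then show ?case using insert by simp
qed (simp add: bounded_polys_const)

lemma bounded_polys_expand:
  assumes "finite I" "p \<in> bounded_polys I D"
  shows "\<exists>a. \<forall>x. p x = (\<Sum>\<alpha>\<in>exponents I D. a \<alpha> * monom_fun I \<alpha> x)"
  using assms(2)
proof induction
  case (mono \<alpha> a)
  have "(\<Sum>\<beta>\<in>exponents I D. (if \<beta> = \<alpha> then a else 0) * monom_fun I \<beta> x) = a * monom_fun I \<alpha> x" for x
  proof -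
    have "(\<Sum>\<beta>\<in>exponents I D. (if \<beta> = \<alpha> then a else 0) * monom_fun I \<beta> x)
        = (\<Sum>\<beta>\<in>exponents I D. if \<beta> = \<alpha> then a * monom_fun I \<beta> x else 0)"
      by (intro sum.cong) auto
    then show ?thesis using mono finite_exponents[OF assms(1), of D] by simp
  qed
  then show ?case by (intro exI[of _ "\<lambda>\<beta>. if \<beta> = \<alpha> then a else 0"]) simp
next
  case (add p q)
  then obtain a b where "\<forall>x. p x = (\<Sum>\<alpha>\<in>exponents I D. a \<alpha> * monom_fun I \<alpha> x)"
    "\<forall>x. q x = (\<Sum>\<alpha>\<in>exponents I D. b \<alpha> * monom_fun I \<alpha> x)" by blast
  then show ?case
    by (intro exI[of _ "\<lambda>\<alpha>. a \<alpha> + b \<alpha>"]) (simp add: distrib_right sum.distrib)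
qed

lemma polyfun_exponents_polys:
  assumes "finite I" "p \<in> polyfun"
  shows "\<exists>D. (\<lambda>x. p (\<lambda>v. if v \<in> I then x v else \<sigma> v)) \<in> bounded_polys I D"
  using assms(2)
proof induction
  case (polyfun_const c)
  then show ?case using bounded_polys_const by blast
next
  case (polyfun_var v)
  then show ?case
    using bounded_polys_var[OF assms(1), of v] bounded_polys_const[of "\<sigma> v" I 0] by (cases "v \<in> I") auto
next
  case (polyfun_add p q)
  then obtain D E where "(\<lambda>x. p (\<lambda>v. if v \<in> I then x v else \<sigma> v)) \<in> bounded_polys I D"
    "(\<lambda>x. q (\<lambda>v. if v \<in> I then x v else \<sigma> v)) \<in> bounded_polys I E" by blast
  then show ?case
    by (intro exI[of _ "max D E"] bounded_polys.add) (auto intro: bounded_polys_mono)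
next
  case (polyfun_mult p q)
  then show ?case using bounded_polys_mult by blast
qed

text \<open>Gaussian elimination with unknowns \<open>A\<close> and equations \<open>B\<close>: one
  equation is removed at a time, together with a pivot unknown \<open>z\<close> if it has a nonzero
  coefficient.\<close>

lemma underdetermined_system:
  fixes M :: "'i \<Rightarrow> 'j \<Rightarrow> 'a::field"
  assumes "finite B" "finite A" "card B < card A"
  shows "\<exists>c. (\<exists>a\<in>A. c a \<noteq> 0) \<and> (\<forall>b\<in>B. (\<Sum>a\<in>A. c a * M a b) = 0)"
  using assms
proof (induction B arbitrary: A M rule: finite_induct)
  case empty
  then obtain a where "a \<in> A" by fastforce
  then show ?case by (intro exI[of _ "\<lambda>_. 1"]) auto
next
  case (insert b B)
  show ?case
  proof (cases "\<forall>a\<in>A. M a b = 0")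
    case True
    obtain c where "\<exists>a\<in>A. c a \<noteq> 0" "\<forall>b\<in>B. (\<Sum>a\<in>A. c a * M a b) = 0"
      using insert.IH[of A M] insert by force
    then show ?thesis using True by (intro exI[of _ c]) auto
  next
    case False
    then obtain z where z: "z \<in> A" "M z b \<noteq> 0" by blast
    let ?A = "A - {z}"
    let ?M = "\<lambda>a b'. M a b' - M a b / M z b * M z b'"
    have "card B < card ?A" using insert z by simp
    then obtain c where c: "\<exists>a\<in>?A. c a \<noteq> 0" "\<And>b'. b' \<in> B \<Longrightarrow> (\<Sum>a\<in>?A. c a * ?M a b') = 0"
      using insert.IH[of ?A ?M] insert.prems(1) by blast
    define s where "s = (\<Sum>a\<in>?A. c a * (M a b / M z b))"
    \<comment> \<open>The value at the pivot is the one that equation \<open>b\<close>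
      dictates.\<close>
    define d where "d = c(z := - s)"
    have sum_d: "(\<Sum>a\<in>A. d a * M a b') = (\<Sum>a\<in>?A. c a * M a b') - s * M z b'" for b'
    proof -
      have "(\<Sum>a\<in>A. d a * M a b') = d z * M z b' + (\<Sum>a\<in>?A. d a * M a b')"
        using insert.prems(1) z(1) by (rule sum.remove)
      moreover have "(\<Sum>a\<in>?A. d a * M a b') = (\<Sum>a\<in>?A. c a * M a b')"
        by (intro sum.cong) (auto simp: d_def)
      ultimately show ?thesis by (simp add: d_def)
    qed
    have "(\<Sum>a\<in>A. d a * M a b') = 0" if "b' \<in> insert b B" for b'
    proof (cases "b' = b")
      case True
      have "s * M z b = (\<Sum>a\<in>?A. c a * M a b)"
        unfolding s_def sum_distrib_right using z(2) by (intro sum.cong) auto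
      then show ?thesis by (simp add: sum_d True)
    next
      case False
      then have "(\<Sum>a\<in>?A. c a * ?M a b') = 0" using that c(2) by simp
      moreover have "(\<Sum>a\<in>?A. c a * ?M a b') = (\<Sum>a\<in>?A. c a * M a b') - s * M z b'"
        unfolding s_def sum_distrib_right sum_subtractf[symmetric]
        by (intro sum.cong) (auto simp: algebra_simps)
      ultimately show ?thesis by (simp add: sum_d)
    qed
    moreover have "\<exists>a\<in>A. d a \<noteq> 0" using c(1) by (auto simp: d_def)
    ultimately show ?thesis by blast
  qed
qed

text \<open>The monomials in the \<open>f j\<close> with exponents up to \<open>D\<close> number
  \<open>(D + 1) ^ card J\<close>, and all lie in the span of \<open>(E + 1) ^ card I\<close>
  monomials in the variables, where \<open>E\<close> is linear in \<open>D\<close>. For large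
  \<open>D\<close> the first number is greater, which forces a linear dependence.\<close>

lemma algebraic_dependence:
  fixes f :: "'j \<Rightarrow> ('v \<Rightarrow> 'a::field) \<Rightarrow> 'a"
  assumes I: "finite I" and J: "finite J" and less: "card I < card J"
    and f: "\<And>j. j \<in> J \<Longrightarrow> f j \<in> polyfun"
  shows "\<exists>D c. (\<exists>\<beta>\<in>exponents J D. c \<beta> \<noteq> 0) \<and>
    (\<forall>x. (\<forall>v. v \<notin> I \<longrightarrow> x v = \<sigma> v) \<longrightarrow> (\<Sum>\<beta>\<in>exponents J D. c \<beta> * monom_fun J \<beta> (\<lambda>j. f j x)) = 0)"
proof -
  define ext where "ext = (\<lambda>(x :: 'v \<Rightarrow> 'a) v. if v \<in> I then x v else \<sigma> v)"
  obtain m where m: "\<And>j. j \<in> J \<Longrightarrow> (\<lambda>x. f j (ext x)) \<in> bounded_polys I (m j)"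
    using polyfun_exponents_polys[OF I f, of _ \<sigma>] unfolding ext_def by metis
  define N where "N = (\<Sum>j\<in>J. m j)"
  have fN: "(\<lambda>x. f j (ext x)) \<in> bounded_polys I N" if "j \<in> J" for j
    using bounded_polys_mono[OF m[OF that]] J that by (simp add: N_def member_le_sum)
  \<comment> \<open>Large enough for the count:
    \<open>E + 1 \<le> (N * card J + 1) * (D + 1)\<close>, hence
    \<open>(E + 1) ^ card I \<le> D * (D + 1) ^ card I\<close>, which is below
    \<open>(D + 1) ^ card J\<close>.\<close>
  define D where "D = (N * card J + 1) ^ card I"
  define E where "E = N * D * card J"
  have "(\<lambda>x. monom_fun J \<beta> (\<lambda>j. f j (ext x))) \<in> bounded_polys I E" if "\<beta> \<in> exponents J D" for \<beta>
    unfolding monom_fun_def E_def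
  proof (rule bounded_polys_prod[OF J])
    fix j assume "j \<in> J"
    then have "\<beta> j \<le> D" using that by (auto simp: exponents_def)
    then show "(\<lambda>x. f j (ext x) ^ \<beta> j) \<in> bounded_polys I (N * D)"
      using bounded_polys_mono[OF bounded_polys_power[OF fN[OF \<open>j \<in> J\<close>]]] by simp
  qed
  then have "\<forall>\<beta>\<in>exponents J D. \<exists>M. \<forall>x. monom_fun J \<beta> (\<lambda>j. f j (ext x))
      = (\<Sum>\<alpha>\<in>exponents I E. M \<alpha> * monom_fun I \<alpha> x)"
    using bounded_polys_expand[OF I] by blast
  then obtain M where M: "\<And>\<beta> x. \<beta> \<in> exponents J D \<Longrightarrow> monom_fun J \<beta> (\<lambda>j. f j (ext x))
      = (\<Sum>\<alpha>\<in>exponents I E. M \<beta> \<alpha> * monom_fun I \<alpha> x)"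
    by metis
  have "card (exponents I E) < card (exponents J D)"
  proof -
    have "Suc E \<le> (N * card J + 1) * Suc D" by (simp add: E_def algebra_simps)
    then have "Suc E ^ card I \<le> D * Suc D ^ card I"
      unfolding D_def power_mult_distrib[symmetric] by (rule power_mono) simp
    also have "\<dots> < Suc D ^ Suc (card I)" by simp
    also have "\<dots> \<le> Suc D ^ card J" using less by (intro power_increasing) auto
    finally show ?thesis using I J by (simp add: card_exponents)
  qed
  from underdetermined_system[OF finite_exponents[OF I] finite_exponents[OF J] this, of M]
  obtain c where c: "\<exists>\<beta>\<in>exponents J D. c \<beta> \<noteq> 0"
    "\<And>\<alpha>. \<alpha> \<in> exponents I E \<Longrightarrow> (\<Sum>\<beta>\<in>exponents J D. c \<beta> * M \<beta> \<alpha>) = 0"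
    by auto
  have "(\<Sum>\<beta>\<in>exponents J D. c \<beta> * monom_fun J \<beta> (\<lambda>j. f j x)) = 0"
    if "\<forall>v. v \<notin> I \<longrightarrow> x v = \<sigma> v" for x
  proof -
    have "ext x = x" using that by (auto simp: ext_def)
    then have "(\<Sum>\<beta>\<in>exponents J D. c \<beta> * monom_fun J \<beta> (\<lambda>j. f j x))
        = (\<Sum>\<beta>\<in>exponents J D. \<Sum>\<alpha>\<in>exponents I E. c \<beta> * M \<beta> \<alpha> * monom_fun I \<alpha> x)"
      using M[of _ x] by (simp add: sum_distrib_left mult.assoc)
    also have "\<dots> = (\<Sum>\<alpha>\<in>exponents I E. (\<Sum>\<beta>\<in>exponents J D. c \<beta> * M \<beta> \<alpha>) * monom_fun I \<alpha> x)"
      by (subst sum.swap) (simp add: sum_distrib_right)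
    finally show ?thesis using c(2) by simp
  qed
  then show ?thesis using c(1) by blast
qed


section \<open>Independence from leading forms\<close>

text \<open>As \<open>m\<close> and \<open>n\<close> are mere upper bounds of the degrees, the
  coefficients there may be zero. They still multiply, because every other term of the convolution
  has a factor beyond its bound.\<close>

lemma coeff_mult_bounds:
  fixes p q :: "'a::comm_ring_1 poly"
  assumes "degree p \<le> m" "degree q \<le> n"
  shows "coeff (p * q) (m + n) = coeff p m * coeff q n"
proof -
  have "coeff (p * q) (m + n) = (\<Sum>i\<le>m + n. coeff p i * coeff q (m + n - i))"
    by (rule coeff_mult)
  also have "\<dots> = (\<Sum>i\<in>{m}. coeff p i * coeff q (m + n - i))"
  proof (rule sum.mono_neutral_right)
    show "\<forall>i\<in>{..m + n} - {m}. coeff p i * coeff q (m + n - i) = 0"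
    proof
      fix i assume "i \<in> {..m + n} - {m}"
      then have "degree p < i \<or> degree q < m + n - i" using assms by auto
      then show "coeff p i * coeff q (m + n - i) = 0" by (auto simp: coeff_eq_0)
    qed
  qed auto
  finally show ?thesis by simp
qed

lemma poly_power_bounds:
  fixes p :: "'a::comm_ring_1 poly"
  assumes "degree p \<le> l"
  shows "degree (p ^ k) \<le> l * k \<and> coeff (p ^ k) (l * k) = coeff p l ^ k"
proof (induction k)
  case (Suc k)
  then have "coeff (p * p ^ k) (l + l * k) = coeff p l * coeff p l ^ k"
    using coeff_mult_bounds[of p l "p ^ k" "l * k"] assms by simp
  moreover have "degree (p * p ^ k) \<le> l + l * k"
    using degree_mult_le[of p "p ^ k"] Suc assms by linarith
  ultimately show ?case by simp
qed simp

lemma poly_prod_power_bounds: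
  fixes P :: "'j \<Rightarrow> 'a::comm_ring_1 poly"
  assumes "finite J" "\<And>j. j \<in> J \<Longrightarrow> degree (P j) \<le> l"
  shows "degree (\<Prod>j\<in>J. P j ^ \<beta> j) \<le> l * (\<Sum>j\<in>J. \<beta> j) \<and>
    coeff (\<Prod>j\<in>J. P j ^ \<beta> j) (l * (\<Sum>j\<in>J. \<beta> j)) = (\<Prod>j\<in>J. coeff (P j) l ^ \<beta> j)"
  using assms
proof (induction rule: finite_induct)
  case (insert j J)
  let ?q = "\<Prod>j\<in>J. P j ^ \<beta> j" and ?s = "\<Sum>j\<in>J. \<beta> j"
  have p: "degree (P j ^ \<beta> j) \<le> l * \<beta> j" "coeff (P j ^ \<beta> j) (l * \<beta> j) = coeff (P j) l ^ \<beta> j"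
    using poly_power_bounds[of "P j" l "\<beta> j"] insert.prems by auto
  have q: "degree ?q \<le> l * ?s" "coeff ?q (l * ?s) = (\<Prod>j\<in>J. coeff (P j) l ^ \<beta> j)"
    using insert by auto
  have "degree (P j ^ \<beta> j * ?q) \<le> l * \<beta> j + l * ?s"
    using degree_mult_le[of "P j ^ \<beta> j" ?q] p(1) q(1) by linarith
  moreover have "coeff (P j ^ \<beta> j * ?q) (l * \<beta> j + l * ?s)
      = coeff (P j) l ^ \<beta> j * (\<Prod>j\<in>J. coeff (P j) l ^ \<beta> j)"
    using coeff_mult_bounds[OF p(1) q(1)] p(2) q(2) by simp
  ultimately show ?case using insert.hyps by (simp add: distrib_left)
qed simp

context infinite_subring
begin

text \<open>Induction on the variables: for fixed values of the others, the sum is a polynomial in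
  \<open>v\<close> with infinitely many roots, so the terms with a given exponent of
  \<open>v\<close> already sum to zero.\<close>

lemma monom_fun_independent:
  assumes "finite I" "finite A" "A \<subseteq> extensional I"
    and "\<And>x. x \<in> slice I \<sigma> \<Longrightarrow> (\<Sum>\<alpha>\<in>A. c \<alpha> * monom_fun I \<alpha> x) = 0"
    and "\<alpha> \<in> A"
  shows "c \<alpha> = 0"
  using assms
proof (induction I arbitrary: A c \<alpha> \<sigma> rule: finite_induct)
  case empty
  then have "A = {\<alpha>}" by auto
  moreover have "\<sigma> \<in> slice {} \<sigma>" by (simp add: slice_def)
  ultimately show ?case using empty.prems(3)[of \<sigma>] by (simp add: monom_fun_def)
next
  case (insert v I)
  define k where "k = \<alpha> v"
  define B where "B = {\<beta> \<in> A. \<beta> v = k}"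
  have finB: "finite B" using insert.prems(1) by (simp add: B_def)
  have inj: "inj_on (\<lambda>\<beta>. restrict \<beta> I) B"
  proof (rule inj_onI)
    fix \<beta> \<gamma> assume *: "\<beta> \<in> B" "\<gamma> \<in> B" "restrict \<beta> I = restrict \<gamma> I"
    have "\<beta> w = \<gamma> w" if "w \<in> insert v I" for w
      using * that by (cases "w = v") (auto simp: B_def dest: fun_cong[of _ _ w])
    then show "\<beta> = \<gamma>" using * insert.prems(2)
      by (intro extensionalityI[of _ "insert v I"]) (auto simp: B_def)
  qed
  have zero: "(\<Sum>\<beta>\<in>B. c \<beta> * monom_fun I \<beta> x) = 0" if x: "x \<in> slice I (\<sigma>)" for x
  proof -
    define P where "P = (\<Sum>\<beta>\<in>A. monom (c \<beta> * monom_fun I \<beta> x) (\<beta> v))"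
    have "P = 0"
    proof (rule poly_eq_0_if_infinite_roots[OF infinite_K])
      fix u assume "u \<in> K"
      then have "x(v := u) \<in> slice (insert v I) \<sigma>" using x by (auto simp: slice_def)
      then have "(\<Sum>\<beta>\<in>A. c \<beta> * monom_fun (insert v I) \<beta> (x(v := u))) = 0"
        by (rule insert.prems(3))
      moreover have "monom_fun (insert v I) \<beta> (x(v := u)) = u ^ \<beta> v * monom_fun I \<beta> x" for \<beta>
      proof -
        have "(\<Prod>w\<in>I. (x(v := u)) w ^ \<beta> w) = (\<Prod>w\<in>I. x w ^ \<beta> w)"
          using insert.hyps by (intro prod.cong) auto
        then show ?thesis using insert.hyps by (simp add: monom_fun_def)
      qed
      ultimately show "poly P u = 0" by (simp add: P_def poly_sum poly_monom mult_ac)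
    qed
    then have "0 = coeff P k" by simp
    also have "\<dots> = (\<Sum>\<beta>\<in>A. if \<beta> v = k then c \<beta> * monom_fun I \<beta> x else 0)"
      unfolding P_def coeff_sum by simp
    also have "\<dots> = (\<Sum>\<beta>\<in>B. c \<beta> * monom_fun I \<beta> x)"
      unfolding B_def using insert.prems(1) by (simp add: sum.inter_filter)
    finally show ?thesis by simp
  qed
  \<comment> \<open>Restriction to \<open>I\<close> is injective on \<open>B\<close>, where all
    exponents agree at \<open>v\<close>; the coefficients are transported along it to apply the
    induction hypothesis.\<close>
  let ?A = "(\<lambda>\<beta>. restrict \<beta> I) ` B"
  define d where "d = (\<lambda>\<gamma>. c (the_inv_into B (\<lambda>\<beta>. restrict \<beta> I) \<gamma>))"
  have d: "d (restrict \<beta> I) = c \<beta>" if "\<beta> \<in> B" for \<beta>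
    using the_inv_into_f_f[OF inj that] by (simp add: d_def)
  have "(\<Sum>\<gamma>\<in>?A. d \<gamma> * monom_fun I \<gamma> x) = 0" if "x \<in> slice I \<sigma>" for x
  proof -
    have "(\<Sum>\<gamma>\<in>?A. d \<gamma> * monom_fun I \<gamma> x) = (\<Sum>\<beta>\<in>B. c \<beta> * monom_fun I \<beta> x)"
      unfolding sum.reindex[OF inj] by (intro sum.cong) (auto simp: d monom_fun_def)
    then show ?thesis using zero[OF that] by simp
  qed
  moreover have "\<alpha> \<in> B" using insert.prems(4) by (simp add: B_def k_def)
  ultimately have "d (restrict \<alpha> I) = 0"
    using finB by (intro insert.IH[of ?A \<sigma> d]) (auto simp del: restrict_apply)
  then show ?case using d \<open>\<alpha> \<in> B\<close> by simp
qed

text \<open>In the top total degree \<open>m\<close>, a relation between the \<open>f v\<close> has the coefficient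
  \<open>\<kappa>\<^sup>m R\<close> at \<open>t\<^bsup>l m\<^esup>\<close>, where \<open>R\<close> is the dehomogenization of the top form of the relation.\<close>

lemma independent_if_leading_forms:
  fixes f :: "'v \<Rightarrow> ('v \<Rightarrow> 'a) \<Rightarrow> 'a"
  assumes I: "finite I" "t \<in> I" and \<sigma>: "range \<sigma> \<subseteq> K" and l: "l > 0"
    and lead: "\<And>v x. v \<in> I \<Longrightarrow> \<exists>P. degree P \<le> l \<and>
      coeff P l = \<kappa> x * (if v = t then 1 else x v) \<and> (\<forall>u. poly P u = f v (x(t := u)))"
    and \<kappa>: "\<kappa> \<in> polyfun" "\<kappa> \<sigma> \<noteq> 0"
    and zero: "\<And>x. x \<in> slice I \<sigma> \<Longrightarrow> (\<Sum>\<beta>\<in>exponents I D. c \<beta> * monom_fun I \<beta> (\<lambda>v. f v x)) = 0"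
    and \<gamma>: "\<gamma> \<in> exponents I D"
  shows "c \<gamma> = 0"
proof (rule ccontr)
  assume "c \<gamma> \<noteq> 0"
  define deg where "deg = (\<lambda>\<beta> :: 'v \<Rightarrow> nat. \<Sum>v\<in>I. \<beta> v)"
  define N where "N = {\<beta> \<in> exponents I D. c \<beta> \<noteq> 0}"
  define m where "m = Max (deg ` N)"
  define A where "A = {\<beta> \<in> N. deg \<beta> = m}"
  let ?I = "I - {t}"
  have fin: "finite (exponents I D)" using I(1) by (rule finite_exponents)
  have N: "finite N" "N \<noteq> {}" using fin \<gamma> \<open>c \<gamma> \<noteq> 0\<close> by (auto simp: N_def)
  have le: "deg \<beta> \<le> m" if "\<beta> \<in> N" for \<beta> unfolding m_def using N(1) that by simp
  have "m \<in> deg ` N" unfolding m_def using N by (intro Max_in) auto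
  then obtain \<alpha> where \<alpha>: "\<alpha> \<in> A" by (auto simp: A_def)
  define R where "R = (\<lambda>x. \<Sum>\<beta>\<in>A. c \<beta> * monom_fun ?I \<beta> x)"
  have top: "\<kappa> x ^ m * R x = 0" if x: "x \<in> slice I \<sigma>" for x
  proof -
    obtain P where P: "\<And>v. v \<in> I \<Longrightarrow> degree (P v) \<le> l"
      "\<And>v. v \<in> I \<Longrightarrow> coeff (P v) l = \<kappa> x * (if v = t then 1 else x v)"
      "\<And>v u. v \<in> I \<Longrightarrow> poly (P v) u = f v (x(t := u))"
      using lead[of _ x] by metis
    define Q where "Q = (\<lambda>\<beta>. \<Prod>v\<in>I. P v ^ \<beta> v)"
    have Q: "degree (Q \<beta>) \<le> l * deg \<beta>"
      "coeff (Q \<beta>) (l * deg \<beta>) = (\<Prod>v\<in>I. coeff (P v) l ^ \<beta> v)" for \<beta>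
      using poly_prod_power_bounds[where \<beta> = \<beta>, OF I(1) P(1)] unfolding Q_def deg_def by auto
    have "(\<Sum>\<beta>\<in>N. smult (c \<beta>) (Q \<beta>)) = 0"
    proof (rule poly_eq_0_if_infinite_roots[OF infinite_K])
      fix u assume "u \<in> K"
      then have "(\<Sum>\<beta>\<in>exponents I D. c \<beta> * monom_fun I \<beta> (\<lambda>v. f v (x(t := u)))) = 0"
        using slice_upd[OF x I(2)] by (intro zero)
      moreover have "(\<Sum>\<beta>\<in>exponents I D. c \<beta> * monom_fun I \<beta> (\<lambda>v. f v (x(t := u))))
          = (\<Sum>\<beta>\<in>N. c \<beta> * monom_fun I \<beta> (\<lambda>v. f v (x(t := u))))"
        using fin by (intro sum.mono_neutral_right) (auto simp: N_def)
      moreover have "poly (Q \<beta>) u = monom_fun I \<beta> (\<lambda>v. f v (x(t := u)))" for \<beta>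
        using P(3) by (simp add: Q_def poly_prod monom_fun_def)
      ultimately show "poly (\<Sum>\<beta>\<in>N. smult (c \<beta>) (Q \<beta>)) u = 0" by (simp add: poly_sum)
    qed
    then have "0 = coeff (\<Sum>\<beta>\<in>N. smult (c \<beta>) (Q \<beta>)) (l * m)" by simp
    also have "\<dots> = (\<Sum>\<beta>\<in>N. c \<beta> * coeff (Q \<beta>) (l * m))" by (simp add: coeff_sum)
    also have "\<dots> = (\<Sum>\<beta>\<in>A. c \<beta> * coeff (Q \<beta>) (l * m))"
    \<comment> \<open>Exponents of total degree below \<open>m\<close> do not reach the power
      \<open>l * m\<close>, as \<open>l > 0\<close>.\<close>
    proof (intro sum.mono_neutral_right ballI)
      fix \<beta> assume "\<beta> \<in> N - A"
      then have "deg \<beta> < m" using le by (force simp: A_def)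
      then have "degree (Q \<beta>) < l * m" using Q(1)[of \<beta>] l by (simp add: le_less_trans)
      then show "c \<beta> * coeff (Q \<beta>) (l * m) = 0" by (simp add: coeff_eq_0)
    qed (use N(1) in \<open>auto simp: A_def\<close>)
    also have "\<dots> = (\<Sum>\<beta>\<in>A. c \<beta> * (\<kappa> x ^ m * monom_fun ?I \<beta> x))"
    proof (intro sum.cong refl)
      fix \<beta> assume "\<beta> \<in> A"
      then have deg: "deg \<beta> = m" by (simp add: A_def)
      have "coeff (Q \<beta>) (l * m) = (\<Prod>v\<in>I. (\<kappa> x * (if v = t then 1 else x v)) ^ \<beta> v)"
        using Q(2)[of \<beta>] P(2) deg by simp
      also have "\<dots> = (\<Prod>v\<in>I. \<kappa> x ^ \<beta> v) * (\<Prod>v\<in>I. (if v = t then 1 else x v) ^ \<beta> v)"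
        by (simp add: power_mult_distrib prod.distrib)
      also have "(\<Prod>v\<in>I. \<kappa> x ^ \<beta> v) = \<kappa> x ^ m"
        using deg by (simp add: power_sum[symmetric] deg_def)
      also have "(\<Prod>v\<in>I. (if v = t then 1 else x v) ^ \<beta> v) = monom_fun ?I \<beta> x"
        unfolding monom_fun_def prod.remove[OF I] by (auto intro!: prod.cong)
      finally show "c \<beta> * coeff (Q \<beta>) (l * m) = c \<beta> * (\<kappa> x ^ m * monom_fun ?I \<beta> x)" by simp
    qed
    finally show ?thesis unfolding R_def by (simp add: sum_distrib_left mult_ac)
  qed
  have R: "R \<in> polyfun" unfolding R_def monom_fun_def by (intro polyfun_intros)
  \<comment> \<open>\<open>\<kappa>\<close> is nonzero at \<open>\<sigma>\<close>. If
    \<open>R\<close> were nonzero somewhere too, both would be nonzero at a common point, against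
    \<open>top\<close>.\<close>
  have R0: "R x = 0" if x: "x \<in> slice I \<sigma>" for x
  proof (rule ccontr)
    assume "R x \<noteq> 0"
    then obtain z where "z \<in> slice I \<sigma>" "\<kappa> z \<noteq> 0" "R z \<noteq> 0"
      using slice_common_nonzero[of \<kappa> R \<sigma> I \<sigma> x] \<kappa> R base_mem_slice[OF \<sigma>] x by blast
    then show False using top[of z] by simp
  qed
  \<comment> \<open>Setting \<open>t\<close> to 1 merges no monomials: all exponents in
    \<open>A\<close> have total degree \<open>m\<close>, which recovers the exponent of
    \<open>t\<close> from the others.\<close>
  have inj: "inj_on (\<lambda>\<beta>. restrict \<beta> ?I) A"
  proof (rule inj_onI)
    fix \<beta> \<delta> assume *: "\<beta> \<in> A" "\<delta> \<in> A" "restrict \<beta> ?I = restrict \<delta> ?I"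
    have eq: "\<beta> w = \<delta> w" if "w \<in> ?I" for w
      using that fun_cong[OF *(3), of w] by simp
    have "\<beta> t + sum \<beta> ?I = \<delta> t + sum \<delta> ?I"
      using * unfolding A_def deg_def by (simp add: sum.remove[OF I])
    moreover have "sum \<beta> ?I = sum \<delta> ?I" by (rule sum.cong) (simp_all add: eq)
    ultimately have "\<beta> t = \<delta> t" by simp
    then have "\<beta> w = \<delta> w" if "w \<in> I" for w using eq that by (cases "w = t") auto
    then show "\<beta> = \<delta>" using *
      by (intro extensionalityI[of _ I]) (auto simp: A_def N_def exponents_def PiE_iff)
  qed
  define d where "d = (\<lambda>\<delta>. c (the_inv_into A (\<lambda>\<beta>. restrict \<beta> ?I) \<delta>))"
  have d: "d (restrict \<beta> ?I) = c \<beta>" if "\<beta> \<in> A" for \<beta>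
    using the_inv_into_f_f[OF inj that] by (simp add: d_def)
  have "d (restrict \<alpha> ?I) = 0"
  proof (rule monom_fun_independent[of ?I "(\<lambda>\<beta>. restrict \<beta> ?I) ` A" \<sigma> d])
    fix x assume "x \<in> slice ?I \<sigma>"
    then have "R x = 0" using R0 slice_mono[OF \<sigma>, of ?I I] by blast
    moreover have "(\<Sum>\<delta>\<in>(\<lambda>\<beta>. restrict \<beta> ?I) ` A. d \<delta> * monom_fun ?I \<delta> x) = R x"
      unfolding sum.reindex[OF inj] R_def by (intro sum.cong) (auto simp: d monom_fun_def)
    ultimately show "(\<Sum>\<delta>\<in>(\<lambda>\<beta>. restrict \<beta> ?I) ` A. d \<delta> * monom_fun ?I \<delta> x) = 0" by simp
  qed (use I N \<alpha> in \<open>auto simp: A_def\<close>)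
  then show False using d[OF \<alpha>] \<alpha> by (simp add: A_def N_def)
qed


section \<open>A lower bound for the dimension\<close>

text \<open>If the closure is a union of two proper closed subsets, each comes with a polynomial
  that vanishes on it but not on the whole image. Pulled back along \<open>\<phi>\<close>, the two
  are nonzero at a common point of the slice, whose image would lie in neither subset.\<close>

lemma irreducible_closure_of_image:
  assumes \<phi>: "\<And>i j. (\<lambda>x. \<phi> x $ i $ j) \<in> polyfun" and \<sigma>: "range \<sigma> \<subseteq> K"
  shows "irreducible_closedin zariski (zariski closure_of (\<phi> ` slice I \<sigma>) :: ('a^'n^'m) set)"
  unfolding irreducible_closedin_def
proof (intro conjI allI impI)
  let ?S = "\<phi> ` slice I \<sigma>" and ?Z = "zariski closure_of (\<phi> ` slice I \<sigma>)"
  have sub: "?S \<subseteq> ?Z" by (intro closure_of_subset) simp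
  show "closedin zariski ?Z" by simp
  show "?Z \<noteq> {}" using sub base_mem_slice[OF \<sigma>] by blast
  fix A B assume AB: "closedin zariski A \<and> closedin zariski B \<and> ?Z = A \<union> B"
  show "?Z = A \<or> ?Z = B"
  proof (rule ccontr)
    assume not: "\<not> ?thesis"
    have escape: "\<exists>p\<in>polyfun. \<exists>x\<in>slice I \<sigma>. p x \<noteq> 0 \<and> (\<forall>z. \<phi> z \<in> C \<longrightarrow> p z = 0)"
      if C: "closedin zariski C" "C \<subseteq> ?Z" "?Z \<noteq> C" for C
    proof -
      obtain F where F: "F \<subseteq> Collect polynomial_map" "C = zero_locus F"
        using C(1) unfolding closedin_zariski by blast
      have "\<not> ?S \<subseteq> C" using closure_of_minimal[OF _ C(1), of ?S] C(2,3) by blast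
      then obtain x where x: "x \<in> slice I \<sigma>" "\<phi> x \<notin> C" by blast
      then obtain g where g: "g \<in> F" "g (\<phi> x) \<noteq> 0" using F(2) by (auto simp: zero_locus_def)
      have "(\<lambda>x. g (\<phi> x)) \<in> polyfun"
        using polyfun_polynomial_map[OF _ \<phi>, of g] g(1) F(1) by blast
      moreover have "\<forall>z. \<phi> z \<in> C \<longrightarrow> g (\<phi> z) = 0" using F(2) g(1) by (auto simp: zero_locus_def)
      ultimately show ?thesis using x(1) g(2) by (intro bexI[of _ "\<lambda>x. g (\<phi> x)"] bexI[of _ x]) auto
    qed
    obtain p x where p: "p \<in> polyfun" "x \<in> slice I \<sigma>" "p x \<noteq> 0" "\<And>z. \<phi> z \<in> A \<Longrightarrow> p z = 0"
      using escape[of A] AB not by blast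
    obtain q y where q: "q \<in> polyfun" "y \<in> slice I \<sigma>" "q y \<noteq> 0" "\<And>z. \<phi> z \<in> B \<Longrightarrow> q z = 0"
      using escape[of B] AB not by blast
    obtain z where z: "z \<in> slice I \<sigma>" "p z \<noteq> 0" "q z \<noteq> 0"
      using slice_common_nonzero[of p q x I \<sigma> y] p q by blast
    then have "\<phi> z \<in> ?Z" using sub by auto
    then have "\<phi> z \<in> A \<or> \<phi> z \<in> B" using AB by simp
    then show False using z p(4) q(4) by auto
  qed
qed

section \<open>Chains of irreducible closed sets\<close>

lemma irreducible_closedin_subtopology:
  assumes "irreducible_closedin \<tau> Z" "closedin \<tau> S" "Z \<subseteq> S"
  shows "irreducible_closedin (subtopology \<tau> S) Z"
proof -
  have iff: "closedin (subtopology \<tau> S) A \<longleftrightarrow> closedin \<tau> A \<and> A \<subseteq> S" for A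
    using assms(2) by (rule closedin_closed_subtopology)
  show ?thesis
    unfolding irreducible_closedin_def
  proof (intro conjI allI impI)
    show "closedin (subtopology \<tau> S) Z" "Z \<noteq> {}"
      using assms(1,3) iff[of Z] unfolding irreducible_closedin_def by blast+
    fix A B
    assume "closedin (subtopology \<tau> S) A \<and> closedin (subtopology \<tau> S) B \<and> Z = A \<union> B"
    then have "closedin \<tau> A \<and> closedin \<tau> B \<and> Z = A \<union> B" using iff by blast
    then show "Z = A \<or> Z = B" using assms(1) by (simp only: irreducible_closedin_def)
  qed
qed

lemma krull_dim_ge_chain:
  assumes "\<And>i. i \<le> d \<Longrightarrow> irreducible_closedin \<tau> (Z i)" "\<And>i. i < d \<Longrightarrow> Z i \<subset> Z (Suc i)"
  shows "enat d \<le> krull_dim \<tau>"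
  unfolding krull_dim_def using assms by (intro Sup_upper) blast

text \<open>\<open>Z i\<close> is the closure of the image when \<open>i\<close> parameters are free
  and the rest stay at \<open>\<sigma>\<close>. If \<open>Z i = Z (Suc i)\<close>, then a relation
  between \<open>i + 1\<close> of the functions \<open>F v\<close>, valid on the smaller image
  because only \<open>i\<close> variables move there, extends to the larger image, where the leading
  forms exclude it.\<close>

theorem zariski_dim_ge_if_leading_forms:
  fixes \<phi> :: "('v \<Rightarrow> 'a) \<Rightarrow> 'a^'n^'m" and F :: "'v \<Rightarrow> 'a^'n^'m \<Rightarrow> 'a"
  assumes I: "finite I" "t \<in> I" and \<sigma>: "range \<sigma> \<subseteq> K" and l: "l > 0"
    and \<phi>: "\<And>i j. (\<lambda>x. \<phi> x $ i $ j) \<in> polyfun"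
    and \<phi>_mem: "\<And>x. range x \<subseteq> K \<Longrightarrow> \<phi> x \<in> S"
    and F: "\<And>v. v \<in> I \<Longrightarrow> polynomial_map (F v)"
    and lead: "\<And>v x. v \<in> I \<Longrightarrow> \<exists>P. degree P \<le> l \<and>
      coeff P l = \<kappa> x * (if v = t then 1 else x v) \<and> (\<forall>u. poly P u = F v (\<phi> (x(t := u))))"
    and \<kappa>: "\<kappa> \<in> polyfun" "\<kappa> \<sigma> \<noteq> 0"
  shows "enat (card I) \<le> zariski_dim S"
proof -
  obtain vs where vs: "set vs = I - {t}" "distinct vs"
    using finite_distinct_list[of "I - {t}"] I(1) by auto
  \<comment> \<open>The parameter \<open>t\<close> comes first, so that it is free in every
    \<open>J (Suc i)\<close>, as the argument with leading forms requires.\<close>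
  let ?ts = "t # vs"
  have ts: "set ?ts = I" "distinct ?ts" "length ?ts = card I"
    using vs I distinct_card[of ?ts] by (auto simp: insert_absorb)
  define J where "J = (\<lambda>i. set (take i ?ts))"
  have J_sub: "J i \<subseteq> I" for i unfolding J_def using set_take_subset[of i ?ts] ts(1) by blast
  have J_mono: "J i \<subseteq> J (Suc i)" for i
    unfolding J_def by (rule set_take_subset_set_take) simp
  have J_card: "card (J i) = i" if "i \<le> card I" for i
    unfolding J_def using distinct_card[of "take i ?ts"] ts(2,3) that by simp
  have t_J: "t \<in> J (Suc i)" for i by (simp add: J_def)
  have J_fin: "finite (J i)" for i by (simp add: J_def)
  define Z where "Z = (\<lambda>i. zariski closure_of (\<phi> ` slice (J i) \<sigma>))"
  have slice_K: "range x \<subseteq> K" if "x \<in> slice (J i) \<sigma>" for x i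
  proof
    fix a assume "a \<in> range x"
    then obtain v where "a = x v" by blast
    then show "a \<in> K" using that \<sigma> by (cases "v \<in> J i") (auto simp: slice_def)
  qed
  have "Z i \<subseteq> zariski closure_of S" for i
    unfolding Z_def using slice_K[of _ i] \<phi>_mem by (intro closure_of_mono image_subsetI) blast
  then have "irreducible_closedin (subtopology zariski (zariski closure_of S)) (Z i)" for i
    unfolding Z_def
    by (intro irreducible_closedin_subtopology irreducible_closure_of_image[OF \<phi> \<sigma>] closedin_closure_of)
  moreover have "Z i \<subset> Z (Suc i)" if i: "i < card I" for i
  proof
    show "Z i \<subseteq> Z (Suc i)"
      unfolding Z_def by (intro closure_of_mono image_mono slice_mono J_mono \<sigma>)
    show "Z i \<noteq> Z (Suc i)"
    proof
      assume eq: "Z i = Z (Suc i)"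
      let ?J = "J (Suc i)"
      have F\<phi>: "(\<lambda>x. F v (\<phi> x)) \<in> polyfun" if "v \<in> ?J" for v
        using polyfun_polynomial_map[OF F \<phi>] that J_sub by blast
      obtain D c where c: "\<exists>\<beta>\<in>exponents ?J D. c \<beta> \<noteq> 0"
        and rel: "\<And>x. \<forall>v. v \<notin> J i \<longrightarrow> x v = \<sigma> v \<Longrightarrow>
          (\<Sum>\<beta>\<in>exponents ?J D. c \<beta> * monom_fun ?J \<beta> (\<lambda>v. F v (\<phi> x))) = 0"
        using algebraic_dependence[where \<sigma> = \<sigma>, OF J_fin[of i] J_fin[of "Suc i"] _ F\<phi>] J_card i by force
      \<comment> \<open>The relation becomes a polynomial on the matrix space; its zero locus is
        closed, so it contains the closure of the smaller image.\<close>
      define H where "H = (\<lambda>A. \<Sum>\<beta>\<in>exponents ?J D. c \<beta> * monom_fun ?J \<beta> (\<lambda>v. F v A))"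
      have "polynomial_map H"
        unfolding H_def monom_fun_def using F J_sub
        by (intro polynomial_map_sum polynomial_map.mult polynomial_map.const
            polynomial_map_prod polynomial_map_power) blast
      then have "closedin zariski (zero_locus {H})" unfolding closedin_zariski by blast
      moreover have "\<phi> ` slice (J i) \<sigma> \<subseteq> zero_locus {H}"
        using rel by (auto simp: H_def zero_locus_def slice_def)
      ultimately have "Z (Suc i) \<subseteq> zero_locus {H}"
        unfolding eq[symmetric] unfolding Z_def by (rule closure_of_minimal[rotated])
      moreover have "\<phi> ` slice ?J \<sigma> \<subseteq> Z (Suc i)" unfolding Z_def by (rule closure_of_subset) simp
      ultimately have "H (\<phi> x) = 0" if "x \<in> slice ?J \<sigma>" for x
        using that by (auto simp: zero_locus_def)
      then have zero: "(\<Sum>\<beta>\<in>exponents ?J D. c \<beta> * monom_fun ?J \<beta> (\<lambda>v. F v (\<phi> x))) = 0"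
        if "x \<in> slice ?J \<sigma>" for x
        using that by (simp only: H_def)
      have "c \<beta> = 0" if "\<beta> \<in> exponents ?J D" for \<beta>
      proof (rule independent_if_leading_forms[where f = "\<lambda>v x. F v (\<phi> x)", OF J_fin t_J \<sigma> l _ \<kappa> zero that])
        fix v x assume "v \<in> ?J"
        then have "v \<in> I" using J_sub by blast
        then show "\<exists>P. degree P \<le> l \<and> coeff P l = \<kappa> x * (if v = t then 1 else x v) \<and>
            (\<forall>u. poly P u = F v (\<phi> (x(t := u))))"
          by (rule lead)
      qed
      then show False using c by blast
    qed
  qed
  ultimately show ?thesis unfolding zariski_dim_def by (intro krull_dim_ge_chain[of _ _ Z])
qed

end


section \<open>Transvections\<close>

definition outer :: "'a::semiring_1^'m \<Rightarrow> 'a^'n \<Rightarrow> 'a^'n^'m" where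
  "outer u v = (\<chi> i j. u $ i * v $ j)"

lemma matrix_mult_outer: "A ** outer u v = outer (A *v u) v"
  by (simp add: outer_def matrix_matrix_mult_def matrix_vector_mult_def vec_eq_iff
      sum_distrib_right mult.assoc)

lemma outer_matrix_mult:
  fixes A :: "'a::comm_semiring_1^'n^'k"
  shows "outer u v ** A = outer u (v v* A)"
  by (simp add: outer_def matrix_matrix_mult_def vector_matrix_mult_def vec_eq_iff
      sum_distrib_left mult_ac)

lemma outer_mult_vector:
  fixes u :: "'a::comm_semiring_1^'m"
  shows "outer u v *v w = scalar_product v w *s u"
  by (simp add: outer_def matrix_vector_mult_def scalar_product_def vec_eq_iff
      sum_distrib_left mult_ac)

lemma vector_mult_outer:
  fixes u :: "'a::comm_semiring_1^'m"
  shows "w v* outer u v = scalar_product w u *s v"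
  by (simp add: outer_def vector_matrix_mult_def scalar_product_def vec_eq_iff
      sum_distrib_left mult_ac)

lemma matrix_add_mult_distrib: "(A + B) ** C = A ** C + B ** C"
  by (simp add: matrix_matrix_mult_def vec_eq_iff distrib_right sum.distrib)

lemma axis_nth_if: "axis k a $ j = (if j = k then a else 0)"
  by (simp add: axis_def)

lemma scalar_product_add_right: "scalar_product v (u + w) = scalar_product v u + scalar_product v w"
  by (simp add: scalar_product_def distrib_left sum.distrib)

lemma scalar_product_axis_left: "scalar_product (axis k a) (v :: 'a::semiring_1^'n) = a * v $ k"
  by (simp add: scalar_product_def axis_def if_distrib[of "\<lambda>x. x * _"] cong: if_cong)

lemma scalar_product_axis_right: "scalar_product (v :: 'a::semiring_1^'n) (axis k a) = v $ k * a"
  by (simp add: scalar_product_def axis_def if_distrib[of "\<lambda>x. _ * x"] cong: if_cong)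

lemma scalar_product_vector_matrix:
  fixes A :: "'a::comm_semiring_1^'n^'m"
  shows "scalar_product (v v* A) u = scalar_product v (A *v u)"
proof -
  have "scalar_product (v v* A) u = (\<Sum>i\<in>UNIV. \<Sum>j\<in>UNIV. v $ j * A $ j $ i * u $ i)"
    by (simp add: scalar_product_def vector_matrix_mult_def sum_distrib_left mult_ac)
  also have "\<dots> = (\<Sum>j\<in>UNIV. \<Sum>i\<in>UNIV. v $ j * A $ j $ i * u $ i)" by (rule sum.swap)
  finally show ?thesis
    by (simp add: scalar_product_def matrix_vector_mult_def sum_distrib_left mult.assoc)
qed

text \<open>A transvection in the strict sense when \<open>scalar_product v u = 0\<close>, as for
  all factors of the frames and letters below.\<close>

definition transvection :: "'a::comm_ring_1^'n \<Rightarrow> 'a^'n \<Rightarrow> 'a^'n^'n" where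
  "transvection u v = mat 1 + outer u v"

lemma transvection_mult_vector: "transvection u v *v w = w + scalar_product v w *s u"
  by (simp add: transvection_def matrix_vector_mult_add_rdistrib outer_mult_vector)

lemma vector_mult_transvection: "w v* transvection u v = w + scalar_product w u *s v"
  by (simp add: transvection_def vector_matrix_mult_add_rdistrib vector_mult_outer)

lemma transvection_mult:
  assumes "scalar_product v u' = 0"
  shows "transvection u v ** transvection u' v = transvection (u + u') v"
proof -
  have "outer u v ** outer u' v = 0"
    using assms by (simp add: matrix_mult_outer outer_mult_vector) (simp add: outer_def vec_eq_iff)
  then show ?thesis
    by (simp add: transvection_def matrix_add_ldistrib matrix_add_mult_distrib)
      (simp add: outer_def vec_eq_iff algebra_simps)
qed

lemma transvection_0: "transvection 0 v = mat 1"
  by (simp add: transvection_def outer_def vec_eq_iff)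

lemma scalar_product_uminus_right:
  "scalar_product v (- u) = - scalar_product v (u :: 'a::comm_ring_1^'n)"
  by (simp add: scalar_product_def sum_negf)

lemma transvection_inverse:
  assumes "scalar_product v u = 0"
  shows "transvection u v ** transvection (- u) v = mat 1"
    "transvection (- u) v ** transvection u v = mat 1"
  using assms by (simp_all add: transvection_mult scalar_product_uminus_right transvection_0)

section \<open>Matrices with polynomial entries\<close>

definition matrix_polyfun :: "(('v \<Rightarrow> 'a::comm_ring_1) \<Rightarrow> 'a^'n^'m) \<Rightarrow> bool" where
  "matrix_polyfun M \<longleftrightarrow> (\<forall>i j. (\<lambda>x. M x $ i $ j) \<in> polyfun)"

lemma matrix_polyfun_const: "matrix_polyfun (\<lambda>x. A)"
  by (simp add: matrix_polyfun_def polyfun_const)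

lemma matrix_polyfun_mult:
  "matrix_polyfun M \<Longrightarrow> matrix_polyfun N \<Longrightarrow> matrix_polyfun (\<lambda>x. M x ** N x)"
  by (simp add: matrix_polyfun_def matrix_matrix_mult_def polyfun_sum polyfun_mult)

lemma matrix_polyfun_transvection:
  assumes "\<And>k. (\<lambda>x. u x $ k) \<in> polyfun" "\<And>k. (\<lambda>x. v x $ k) \<in> polyfun"
  shows "matrix_polyfun (\<lambda>x. transvection (u x) (v x))"
  using assms unfolding matrix_polyfun_def transvection_def outer_def
  by (auto intro!: polyfun_intros)

lemma polyfun_det: "matrix_polyfun M \<Longrightarrow> (\<lambda>x. det (M x)) \<in> polyfun"
  unfolding det_def matrix_polyfun_def by (auto intro!: polyfun_intros)

text \<open>The determinant of \<open>1 + x u v\<close> is a polynomial in \<open>x\<close> and a unit, hence constant.\<close>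

lemma det_transvection:
  fixes u v :: "'a::field^'n"
  assumes "infinite (UNIV :: 'a set)" and vu: "scalar_product v u = 0"
  shows "det (transvection u v) = 1"
proof -
  let ?D = "\<lambda>s :: unit \<Rightarrow> 'a. det (transvection (s () *s u) v)"
  have "?D \<in> polyfun"
    by (intro polyfun_det matrix_polyfun_transvection)
      (auto intro!: polyfun_intros)
  then obtain P where P: "\<And>a. poly P a = ?D (\<lambda>_. 0 + a * (1 - 0))"
    using polyfun_on_line[of ?D "\<lambda>_. 0" "\<lambda>_. 1"] by metis
  \<comment> \<open>\<open>pcompose P [:0, -1:]\<close> has the value \<open>poly P (- a)\<close> at
    \<open>a\<close>, and the parameters \<open>a\<close> and \<open>- a\<close> give inverse
    matrices.\<close>
  have "poly (P * pcompose P [:0, -1:] - 1) a = 0" for a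
  proof -
    have "- (a *s u) = (- a) *s u" by (simp add: vec_eq_iff)
    moreover have "scalar_product v (a *s u) = 0"
      using vu by (simp add: scalar_product_def sum_distrib_left[symmetric] mult.left_commute)
    ultimately have "transvection (a *s u) v ** transvection ((- a) *s u) v = mat 1"
      using transvection_inverse(1)[of v "a *s u"] by simp
    then have "det (transvection (a *s u) v) * det (transvection ((- a) *s u) v) = 1"
      by (metis det_mul det_I)
    then show ?thesis by (simp add: poly_pcompose P)
  qed
  then have "P * pcompose P [:0, -1:] = 1"
    using poly_eq_0_if_infinite_roots[OF assms(1)] by (metis eq_iff_diff_eq_0)
  then have "P dvd 1" by (metis dvd_triv_left)
  then obtain c where "P = [:c:]" by (auto simp: is_unit_poly_iff)
  then have "det (transvection u v) = poly P 0" using P[of 1] by simp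
  then show ?thesis using P[of 0] by (simp add: transvection_0)
qed


section \<open>Leading coefficients of one-parameter families of matrices\<close>

text \<open>\<open>A\<close> collects the coefficients at \<open>u ^ l\<close> and may vanish. As
  \<open>l\<close> only bounds the degree from above, these coefficients multiply without further
  conditions.\<close>

definition has_lead :: "nat \<Rightarrow> 'a::comm_ring_1^'n^'m \<Rightarrow> ('a \<Rightarrow> 'a^'n^'m) \<Rightarrow> bool" where
  "has_lead l A F \<longleftrightarrow> (\<forall>i j. \<exists>P. degree P \<le> l \<and> coeff P l = A $ i $ j \<and> (\<forall>u. poly P u = F u $ i $ j))"

lemma has_lead_const: "has_lead 0 A (\<lambda>u. A)"
  unfolding has_lead_def
proof (intro allI)
  fix i j show "\<exists>P. degree P \<le> 0 \<and> coeff P 0 = A $ i $ j \<and> (\<forall>u. poly P u = A $ i $ j)"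
    by (intro exI[of _ "[:A $ i $ j:]"]) simp
qed

lemma has_lead_linear:
  assumes "\<And>u. F u = B + (\<chi> i j. u * A $ i $ j)"
  shows "has_lead 1 A F"
  unfolding has_lead_def
proof (intro allI)
  fix i j
  show "\<exists>P. degree P \<le> 1 \<and> coeff P 1 = A $ i $ j \<and> (\<forall>u. poly P u = F u $ i $ j)"
    by (intro exI[of _ "[:B $ i $ j, A $ i $ j:]"]) (simp add: assms)
qed

lemma has_lead_mult:
  assumes "has_lead l A F" "has_lead m B G"
  shows "has_lead (l + m) (A ** B) (\<lambda>u. F u ** G u)"
  unfolding has_lead_def
proof (intro allI)
  fix i j
  obtain P where P: "\<And>k. degree (P k) \<le> l" "\<And>k. coeff (P k) l = A $ i $ k"
    "\<And>k u. poly (P k) u = F u $ i $ k"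
    using assms(1) unfolding has_lead_def by metis
  have "\<forall>k. \<exists>Q. degree Q \<le> m \<and> coeff Q m = B $ k $ j \<and> (\<forall>u. poly Q u = G u $ k $ j)"
    using assms(2) unfolding has_lead_def by blast
  then obtain Q where Q: "\<And>k. degree (Q k) \<le> m" "\<And>k. coeff (Q k) m = B $ k $ j"
    "\<And>k u. poly (Q k) u = G u $ k $ j"
    by metis
  let ?R = "\<Sum>k\<in>UNIV. P k * Q k"
  have "degree (P k * Q k) \<le> l + m" for k
    using degree_mult_le[of "P k" "Q k"] P(1)[of k] Q(1)[of k] by linarith
  then have "degree ?R \<le> l + m" by (intro degree_sum_le) auto
  moreover have "coeff ?R (l + m) = (A ** B) $ i $ j"
    using coeff_mult_bounds[OF P(1) Q(1)] P(2) Q(2)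
    by (simp add: coeff_sum matrix_matrix_mult_def)
  moreover have "poly ?R u = (F u ** G u) $ i $ j" for u
    using P(3) Q(3) by (simp add: poly_sum matrix_matrix_mult_def)
  ultimately show "\<exists>P. degree P \<le> l + m \<and> coeff P (l + m) = (A ** B) $ i $ j \<and>
      (\<forall>u. poly P u = (F u ** G u) $ i $ j)"
    by blast
qed


section \<open>A family of elements of the special linear group\<close>

text \<open>A pair \<open>(i, \<epsilon>)\<close> stands for the letter \<open>x\<^sub>i\<^sup>\<epsilon>\<close>. Each has a frame \<open>h\<^bsub>i,\<epsilon>\<^esub>\<close> in the special linear
  group, with \<open>p = h e\<close> and \<open>q = e' h\<^sup>-\<^sup>1\<close> for the unit vectors \<open>e\<close>, \<open>e'\<close> at \<open>k0\<close>, \<open>k1\<close>, and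
  \<open>x\<^sub>i\<^sup>\<epsilon>\<close> is sent to \<open>h\<^bsub>i,\<epsilon>\<^esub> (1 + \<epsilon> t e e') h\<^bsub>i,-\<epsilon>\<^esub>\<^sup>-\<^sup>1\<close>. The index \<open>None\<close> is that of \<open>t\<close>.\<close>

type_synonym 'n param = "((nat \<times> int) \<times> bool \<times> 'n) option"

fun opp :: "nat \<times> int \<Rightarrow> nat \<times> int" where
  "opp (i, \<epsilon>) = (i, - \<epsilon>)"

locale frames = infinite_subring K for K :: "'a::field set" +
  fixes k0 k1 :: "'n::finite"
  assumes k01: "k0 \<noteq> k1"
begin

text \<open>The column \<open>p\<close>, its scaling fixed by the entry 1 at
  \<open>k0\<close>.\<close>

definition pvec :: "('n param \<Rightarrow> 'a) \<Rightarrow> nat \<times> int \<Rightarrow> 'a^'n" where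
  "pvec x y = (\<chi> k. if k = k0 then 1 else x (Some (y, True, k)))"

text \<open>The free part of the row \<open>q\<close>. The entry 1 at \<open>k1\<close> fixes the
  scaling; the entry of \<open>q\<close> at \<open>k0\<close> is forced by \<open>q p = 0\<close>,
  so 0 stands in its place here.\<close>

definition rvec :: "('n param \<Rightarrow> 'a) \<Rightarrow> nat \<times> int \<Rightarrow> 'a^'n" where
  "rvec x y = (\<chi> k. if k = k0 then 0 else if k = k1 then 1 else x (Some (y, False, k)))"

text \<open>The second factor fixes the column \<open>axis k0 1\<close>, and the first takes it to
  \<open>p\<close>. The inverse of the second factor takes the row \<open>axis k1 1\<close> to
  \<open>rvec x y\<close>.\<close>

definition frame :: "('n param \<Rightarrow> 'a) \<Rightarrow> nat \<times> int \<Rightarrow> 'a^'n^'n" where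
  "frame x y = transvection (pvec x y - axis k0 1) (axis k0 1) **
    transvection (- axis k1 1) (rvec x y - axis k1 1)"

text \<open>The inverse of the frame, written as a product of transvections so that its entries are
  visibly polynomial in the parameters.\<close>

definition coframe :: "('n param \<Rightarrow> 'a) \<Rightarrow> nat \<times> int \<Rightarrow> 'a^'n^'n" where
  "coframe x y = transvection (axis k1 1) (rvec x y - axis k1 1) **
    transvection (- (pvec x y - axis k0 1)) (axis k0 1)"

definition qvec :: "('n param \<Rightarrow> 'a) \<Rightarrow> nat \<times> int \<Rightarrow> 'a^'n" where
  "qvec x y = axis k1 1 v* coframe x y"

text \<open>Ending in the coframe of the opposite letter makes \<open>letter x (opp y)\<close> the
  inverse of \<open>letter x y\<close>, while the two ends of a letter keep separate
  parameters.\<close>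

definition letter :: "('n param \<Rightarrow> 'a) \<Rightarrow> nat \<times> int \<Rightarrow> 'a^'n^'n" where
  "letter x y = frame x y ** transvection (axis k0 (of_int (snd y) * x None)) (axis k1 1) **
    coframe x (opp y)"

lemma infinite_UNIV_field: "infinite (UNIV :: 'a set)"
  by (rule infinite_super[OF subset_UNIV infinite_K])

lemma orthogonal:
  "scalar_product (axis k0 1) (pvec x y - axis k0 1) = 0"
  "scalar_product (rvec x y - axis k1 1) (axis k1 1) = 0"
  "scalar_product (axis k1 1 :: 'a^'n) (axis k0 a) = 0"
  using k01 by (simp_all add: scalar_product_axis_left scalar_product_axis_right pvec_def rvec_def axis_nth_if)

lemma frame_coframe: "frame x y ** coframe x y = mat 1" "coframe x y ** frame x y = mat 1"
proof -
  let ?L = "transvection (pvec x y - axis k0 1) (axis k0 1)"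
    and ?L' = "transvection (- (pvec x y - axis k0 1)) (axis k0 1)"
    and ?R = "transvection (- axis k1 1) (rvec x y - axis k1 1)"
    and ?R' = "transvection (axis k1 1) (rvec x y - axis k1 1)"
  have L: "?L ** ?L' = mat 1" "?L' ** ?L = mat 1" using transvection_inverse[OF orthogonal(1)] by auto
  have R: "?R ** ?R' = mat 1" "?R' ** ?R = mat 1" using transvection_inverse[OF orthogonal(2)] by auto
  show "frame x y ** coframe x y = mat 1" "coframe x y ** frame x y = mat 1"
    unfolding frame_def coframe_def
    by (metis L(1) R(1) matrix_mul_assoc matrix_mul_rid) (metis L(2) R(2) matrix_mul_assoc matrix_mul_rid)
qed

lemma frame_axis: "frame x y *v axis k0 1 = pvec x y"
proof -
  have "scalar_product (rvec x y - axis k1 1) (axis k0 1) = 0"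
    using k01 by (simp add: scalar_product_axis_right rvec_def axis_nth_if)
  then show ?thesis
    by (simp add: frame_def matrix_vector_mul_assoc[symmetric] transvection_mult_vector
        scalar_product_axis_left)
qed

lemma qvec_nth:
  "qvec x y $ k = (if k = k0 then - (\<Sum>j\<in>UNIV. rvec x y $ j * pvec x y $ j) else rvec x y $ k)"
proof -
  have "axis k1 1 v* transvection (axis k1 1) (rvec x y - axis k1 1) = rvec x y"
    by (simp add: vector_mult_transvection scalar_product_axis_left)
  then have "qvec x y = rvec x y v* transvection (- (pvec x y - axis k0 1)) (axis k0 1)"
    unfolding qvec_def coframe_def vector_matrix_mul_assoc[symmetric] by simp
  also have "\<dots> = rvec x y - scalar_product (rvec x y) (pvec x y - axis k0 1) *s axis k0 1"
    by (simp only: vector_mult_transvection scalar_product_uminus_right) (simp add: vec_eq_iff)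
  also have "scalar_product (rvec x y) (pvec x y - axis k0 1) = scalar_product (rvec x y) (pvec x y)"
  proof -
    have "scalar_product (rvec x y) (axis k0 1) = 0"
      by (simp add: scalar_product_axis_right rvec_def)
    then show ?thesis by (simp add: scalar_product_def right_diff_distrib sum_subtractf)
  qed
  finally show ?thesis by (auto simp: scalar_product_def rvec_def axis_nth_if)
qed

text \<open>Eliminating the forced entry of \<open>q\<close> at \<open>k0\<close> shows that
  \<open>q z\<close> pairs \<open>rvec\<close> with the deviation of \<open>z\<close> from the
  multiple of \<open>p\<close> that agrees with it at \<open>k0\<close>.\<close>

lemma scalar_product_qvec:
  "scalar_product (qvec x y) z = (\<Sum>k\<in>UNIV. rvec x y $ k * (z $ k - z $ k0 * pvec x y $ k))"
proof -
  have "scalar_product (qvec x y) z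
      = (\<Sum>k\<in>UNIV. (rvec x y $ k - (if k = k0 then \<Sum>j\<in>UNIV. rvec x y $ j * pvec x y $ j else 0)) * z $ k)"
    unfolding scalar_product_def by (intro sum.cong) (auto simp: qvec_nth rvec_def)
  also have "\<dots> = (\<Sum>k\<in>UNIV. rvec x y $ k * z $ k) - (\<Sum>j\<in>UNIV. rvec x y $ j * pvec x y $ j) * z $ k0"
    by (simp add: left_diff_distrib sum_subtractf if_distrib[of "\<lambda>a. a * _"] cong: if_cong)
  finally show ?thesis
    by (simp add: right_diff_distrib sum_subtractf sum_distrib_right sum_distrib_left mult_ac)
qed

lemma letter_inverse: "letter x y ** letter x (opp y) = mat 1"
proof -
  obtain i \<epsilon> where y: "y = (i, \<epsilon>)" by fastforce
  let ?T = "transvection (axis k0 (of_int \<epsilon> * x None)) (axis k1 1) :: 'a^'n^'n"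
    and ?T' = "transvection (axis k0 (of_int (- \<epsilon>) * x None)) (axis k1 1) :: 'a^'n^'n"
  have "axis k0 (of_int (- \<epsilon>) * x None) = - axis k0 (of_int \<epsilon> * x None)"
    by (simp add: vec_eq_iff axis_nth_if)
  then have T: "?T ** ?T' = mat 1" using transvection_inverse(1)[OF orthogonal(3)] by simp
  have "letter x y ** letter x (opp y)
      = frame x y ** (?T ** (coframe x (opp y) ** frame x (opp y)) ** ?T') ** coframe x y"
    unfolding letter_def y by (simp add: matrix_mul_assoc)
  also have "\<dots> = mat 1" by (simp only: frame_coframe matrix_mul_rid T)
  finally show ?thesis .
qed

text \<open>The frames do not involve \<open>x None\<close>, so a letter is affine in
  \<open>t\<close>, and its slope is a column times a row.\<close>

lemma letter_None: "letter (x(None := u)) y = frame x y ** coframe x (opp y) +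
    (\<chi> i j. u * outer (of_int (snd y) *s pvec x y) (qvec x (opp y)) $ i $ j)"
proof -
  have "pvec (x(None := u)) z = pvec x z" "rvec (x(None := u)) z = rvec x z" for z
    by (auto simp: pvec_def rvec_def vec_eq_iff)
  then have fr: "frame (x(None := u)) z = frame x z" "coframe (x(None := u)) z = coframe x z" for z
    by (simp_all add: frame_def coframe_def)
  have "frame x y *v axis k0 a = a *s pvec x y" for a
  proof -
    have "axis k0 a = a *s axis k0 1" by (simp add: vec_eq_iff axis_nth_if)
    then show ?thesis by (simp add: frame_axis vector_scalar_commute)
  qed
  then have "letter (x(None := u)) y = frame x y ** coframe x (opp y) +
      outer ((of_int (snd y) * u) *s pvec x y) (qvec x (opp y))"
    unfolding letter_def fr transvection_def qvec_def
    by (simp add: matrix_add_ldistrib matrix_add_mult_distrib matrix_mult_outer outer_matrix_mult)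
  then show ?thesis by (simp add: outer_def vec_eq_iff mult_ac)
qed

lemma has_lead_letter:
  "has_lead 1 (outer (of_int (snd y) *s pvec x y) (qvec x (opp y))) (\<lambda>u. letter (x(None := u)) y)"
  by (rule has_lead_linear) (rule letter_None)

section \<open>Polynomial dependence on the parameters and membership in SL\<close>

lemma polyfun_pvec: "(\<lambda>x. pvec x y $ k) \<in> polyfun"
  by (cases "k = k0") (simp_all add: pvec_def polyfun_intros)

lemma polyfun_rvec: "(\<lambda>x. rvec x y $ k) \<in> polyfun"
  unfolding rvec_def vec_lambda_beta
  by (cases "k = k0"; cases "k = k1") (simp_all add: polyfun_intros)

lemma matrix_polyfun_frame: "matrix_polyfun (\<lambda>x. frame x y)" "matrix_polyfun (\<lambda>x. coframe x y)"
  unfolding frame_def coframe_def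
  by (auto intro!: matrix_polyfun_mult matrix_polyfun_transvection polyfun_intros
      polyfun_pvec polyfun_rvec)

lemma matrix_polyfun_letter: "matrix_polyfun (\<lambda>x. letter x y)"
proof -
  have "(\<lambda>x. axis k0 (of_int (snd y) * x None) $ k) \<in> polyfun" for k
    by (cases "k = k0") (auto simp: axis_nth_if intro!: polyfun_intros)
  then show ?thesis
    unfolding letter_def
    by (intro matrix_polyfun_mult matrix_polyfun_frame matrix_polyfun_transvection polyfun_const)
qed

lemma polyfun_qvec: "(\<lambda>x. qvec x y $ k) \<in> polyfun"
  unfolding qvec_def vector_matrix_mult_def
  using matrix_polyfun_frame(2)[of y] by (auto simp: matrix_polyfun_def intro!: polyfun_intros)

lemma SL_mult: "A \<in> SL K \<Longrightarrow> B \<in> SL K \<Longrightarrow> A ** B \<in> SL K"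
  using det_mul[of A B] by (auto simp: SL_def) (auto simp: matrix_matrix_mult_def intro!: sum_mem mult_mem)

lemma SL_transvection:
  assumes "\<And>k. u $ k \<in> K" "\<And>k. v $ k \<in> K" "scalar_product v u = 0"
  shows "transvection u v \<in> SL K"
  using assms det_transvection[OF infinite_UNIV_field assms(3)]
  by (auto simp: SL_def transvection_def outer_def mat_def
      intro!: add_mem mult_mem one_mem zero_mem)

lemma frame_mem_SL:
  assumes "range x \<subseteq> K"
  shows "frame x y \<in> SL K" "coframe x y \<in> SL K"
proof -
  have x: "x v \<in> K" for v using assms by blast
  have [intro]: "pvec x y $ k \<in> K" "rvec x y $ k \<in> K" "axis l (1::'a) $ k \<in> K" for k l :: 'n
    using x by (auto simp: pvec_def rvec_def axis_nth_if zero_mem one_mem)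
  show "frame x y \<in> SL K" "coframe x y \<in> SL K"
    unfolding frame_def coframe_def
    by (auto intro!: SL_mult SL_transvection diff_mem uminus_mem
        simp: orthogonal scalar_product_uminus_right simp del: minus_diff_eq)
qed

lemma letter_mem_SL:
  assumes "range x \<subseteq> K" "snd y \<in> {1, -1}"
  shows "letter x y \<in> SL K"
proof -
  have "x None \<in> K" using assms(1) by blast
  then have "axis k0 (of_int (snd y) * x None) $ k \<in> K" for k
    using assms(2) by (auto simp: axis_nth_if zero_mem uminus_mem)
  moreover have "axis k1 (1::'a) $ k \<in> K" for k by (simp add: axis_nth_if zero_mem one_mem)
  ultimately show ?thesis
    unfolding letter_def using assms
    by (intro SL_mult frame_mem_SL SL_transvection orthogonal)
qed


subsection \<open>Nonvanishing of the connecting factors\<close>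

lemma exists_parameters:
  assumes "\<And>y k. p y $ k \<in> K" "\<And>y k. \<rho> y $ k \<in> K"
    and "\<And>y. p y $ k0 = 1" "\<And>y. \<rho> y $ k0 = 0" "\<And>y. \<rho> y $ k1 = 1"
  obtains x where "range x \<subseteq> K" "pvec x = p" "rvec x = \<rho>"
proof
  let ?x = "\<lambda>v. case v of None \<Rightarrow> 0 | Some (y, b, k) \<Rightarrow> if b then p y $ k else \<rho> y $ k"
  show "range ?x \<subseteq> K" using assms(1,2) zero_mem by (auto split: option.split)
  show "pvec ?x = p" "rvec ?x = \<rho>"
    using assms(3-5) by (auto simp: pvec_def rvec_def fun_eq_iff vec_eq_iff)
qed

text \<open>Row and column belong to different frames and vary independently. The choice of
  \<open>axis k0 1\<close> for \<open>p\<close> and \<open>axis k1 1\<close> for \<open>rvec\<close>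
  at \<open>y\<close> gives \<open>axis k1 1\<close> for \<open>q\<close>; it remains to pair row
  \<open>k1\<close> of \<open>c\<close>, nonzero by invertibility, with a suitable column.\<close>

lemma noncritical_factor:
  assumes "invertible c" "y \<noteq> y'"
  shows "\<exists>x. range x \<subseteq> K \<and> scalar_product (qvec x y v* c) (pvec x y') \<noteq> 0"
proof -
  have "\<exists>k. c $ k1 $ k \<noteq> 0"
  proof (rule ccontr)
    assume "\<not> ?thesis"
    then have "axis k1 1 v* c = 0"
      by (simp add: vec_eq_iff vector_matrix_mult_def axis_nth_if if_distrib[of "\<lambda>a. a * _"] cong: if_cong)
    moreover obtain d where "c ** d = mat 1" using assms(1) by (auto simp: invertible_def)
    ultimately have "axis k1 1 = (0 :: 'a^'n)"
      by (metis vector_matrix_mul_assoc vector_matrix_mul_rid vector_matrix_mult_0)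
    from arg_cong[OF this, of "\<lambda>v. v $ k1"] show False by simp
  qed
  then obtain k where k: "c $ k1 $ k \<noteq> 0" by blast
  \<comment> \<open>An admissible column has the entry 1 at \<open>k0\<close>. If row
    \<open>k1\<close> of \<open>c\<close> vanishes at \<open>k0\<close>, then
    \<open>k \<noteq> k0\<close>, and the added unit vector makes the product nonzero.\<close>
  define s :: "'a^'n" where "s = (if c $ k1 $ k0 \<noteq> 0 then axis k0 1 else axis k0 1 + axis k 1)"
  have s: "scalar_product (c $ k1) s \<noteq> 0" "s $ k0 = 1" "\<And>j. s $ j \<in> K"
  proof -
    show "scalar_product (c $ k1) s \<noteq> 0"
      using k by (simp add: s_def scalar_product_add_right scalar_product_axis_right)
    show "s $ k0 = 1" using k by (auto simp: s_def axis_nth_if)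
    show "s $ j \<in> K" for j by (auto simp: s_def axis_nth_if zero_mem one_mem add_mem)
  qed
  let ?p = "\<lambda>z. if z = y then axis k0 1 else s"
  have p: "?p z $ j \<in> K" "?p z $ k0 = 1" for z j
    using s(2,3) by (auto simp: axis_nth_if zero_mem one_mem)
  have r: "axis k1 1 $ j \<in> K" "axis k1 1 $ k0 = (0::'a)" "axis k1 1 $ k1 = (1::'a)" for j
    using k01 by (auto simp: axis_nth_if zero_mem one_mem)
  obtain x where x: "range x \<subseteq> K" "pvec x = ?p" "rvec x = (\<lambda>z. axis k1 1)"
    by (rule exists_parameters[of ?p "\<lambda>z. axis k1 1", OF p(1) r(1) p(2) r(2,3)])
  have "scalar_product (qvec x y v* c) (pvec x y') = scalar_product (qvec x y) (c *v s)"
    using assms(2) by (simp add: scalar_product_vector_matrix x(2))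
  also have "\<dots> = (c *v s) $ k1"
    using k01 by (simp add: scalar_product_qvec x(2,3) axis_nth_if if_distrib[of "\<lambda>a. a * _"] cong: if_cong)
  also have "\<dots> = scalar_product (c $ k1) s"
    by (simp add: matrix_vector_mult_def scalar_product_def)
  finally show ?thesis using s(1) x(1) by (intro exI[of _ x]) simp
qed

text \<open>Row and column come from the same frame. If the product always vanished, then varying
  the row would make every column with entries in \<open>K\<close> and entry 1 at \<open>k0\<close>
  an eigenvector of \<open>c\<close>, which forces \<open>c\<close> to be scalar.\<close>

lemma critical_factor:
  assumes "\<And>a. c \<noteq> mat a"
  shows "\<exists>x. range x \<subseteq> K \<and> scalar_product (qvec x y v* c) (pvec x y) \<noteq> 0"
proof (rule ccontr)
  assume "\<not> ?thesis"
  then have zero: "\<And>x. range x \<subseteq> K \<Longrightarrow> scalar_product (qvec x y v* c) (pvec x y) = 0" by blast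
  have eigen: "(c *v p) $ k = (c *v p) $ k0 * p $ k" if p: "\<And>k. p $ k \<in> K" "p $ k0 = 1" for p k
  proof -
    let ?d = "\<lambda>k. (c *v p) $ k - (c *v p) $ k0 * p $ k"
    have *: "(\<Sum>k\<in>UNIV. \<rho> $ k * ?d k) = 0"
      if \<rho>: "\<And>k. \<rho> $ k \<in> K" "\<rho> $ k0 = 0" "\<rho> $ k1 = 1" for \<rho> :: "'a^'n"
    proof -
      obtain x where "range x \<subseteq> K" "pvec x = (\<lambda>_. p)" "rvec x = (\<lambda>_. \<rho>)"
        by (rule exists_parameters[of "\<lambda>_. p" "\<lambda>_. \<rho>"]) (use p \<rho> in auto)
      then show ?thesis
        using zero[of x] by (simp add: scalar_product_vector_matrix scalar_product_qvec)
    qed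
    have d1: "?d k1 = 0"
      using *[of "axis k1 1"] k01
      by (simp add: axis_nth_if zero_mem one_mem if_distrib[of "\<lambda>a. a * _"] cong: if_cong)
    have "?d k = 0"
    proof (cases "k = k0 \<or> k = k1")
      case True
      then show ?thesis using d1 p(2) by auto
    next
      case False
      \<comment> \<open>Admissible rows have the entry 1 at \<open>k1\<close>; hence the unit row at
        \<open>k\<close> is tested together with the one at \<open>k1\<close>, whose contribution is
        zero by \<open>d1\<close>.\<close>
      then have "(\<Sum>j\<in>UNIV. (axis k1 1 + axis k 1) $ j * ?d j) = 0"
        using k01 by (intro *) (auto simp: axis_nth_if zero_mem one_mem)
      then show ?thesis
        using d1 by (simp add: axis_nth_if distrib_right sum.distrib if_distrib[of "\<lambda>a. a * _"] cong: if_cong)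
    qed
    then show ?thesis by simp
  qed
  \<comment> \<open>The eigenvector condition for the test columns
    \<open>axis k0 1 + axis j a\<close>.\<close>
  have entries: "c $ k $ k0 + a * c $ k $ j = (c $ k0 $ k0 + a * c $ k0 $ j) *
      ((if k = k0 then 1 else 0) + (if k = j then a else 0))"
    if "a \<in> K" "j \<noteq> k0" for a j k
  proof -
    have "(c *v (axis k0 1 + axis j a)) $ l = c $ l $ k0 + a * c $ l $ j" for l
      by (simp add: matrix_vector_mult_def axis_nth_if distrib_left sum.distrib
          if_distrib[of "\<lambda>a. _ * a"] mult.commute cong: if_cong)
    then show ?thesis
      using eigen[of "axis k0 1 + axis j a" k] that
      by (auto simp: axis_nth_if zero_mem one_mem add_mem)
  qed
  have col0: "c $ k $ k0 = 0" if "k \<noteq> k0" for k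
    using entries[of 0 k1 k] that k01 zero_mem by simp
  have off: "c $ k $ j = 0" if "k \<noteq> k0" "j \<noteq> k0" "k \<noteq> j" for k j
    using entries[of 1 j k] that col0 one_mem by simp
  have diag: "c $ k0 $ j = 0 \<and> c $ j $ j = c $ k0 $ k0" if "j \<noteq> k0" for j
  proof -
    have eq: "c $ j $ j = c $ k0 $ k0 + a * c $ k0 $ j" if "a \<in> K" "a \<noteq> 0" for a
      using entries[of a j j] \<open>j \<noteq> k0\<close> that col0[of j] by simp
    \<comment> \<open>The right-hand side of \<open>eq\<close> is affine in \<open>a\<close>;
      comparing \<open>a = 1\<close> with another nonzero value kills its slope.\<close>
    have "infinite (K - {0, 1})" using infinite_K by simp
    then obtain a where a: "a \<in> K" "a \<noteq> 0" "a \<noteq> 1"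
      by (metis DiffE ex_in_conv finite.emptyI insertCI)
    have "(a - 1) * c $ k0 $ j = 0" using eq[OF a(1,2)] eq[of 1] one_mem by (simp add: algebra_simps)
    then show ?thesis using a(3) eq[OF a(1,2)] by simp
  qed
  have "c = mat (c $ k0 $ k0)"
    unfolding vec_eq_iff
  proof (intro allI)
    fix k j show "c $ k $ j = mat (c $ k0 $ k0) $ k $ j"
      using col0[of k] off[of k j] diag[of j] by (cases "k = k0"; cases "j = k0"; cases "k = j") (auto simp: mat_def)
  qed
  then show False using assms by blast
qed

end


section \<open>Words\<close>

text \<open>Positions count from 0, in contrast to \<open>word_var\<close> and
  \<open>word_exp\<close>: \<open>letter_at ws j\<close> is followed by
  \<open>const_at ws j\<close>, which is \<open>word_const w (Suc j)\<close> for
  \<open>ws = snd w\<close>.\<close>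

definition letter_at :: "(nat \<times> int \<times> 'c) list \<Rightarrow> nat \<Rightarrow> nat \<times> int" where
  "letter_at ws j = (fst (ws ! j), fst (snd (ws ! j)))"

definition const_at :: "(nat \<times> int \<times> 'c) list \<Rightarrow> nat \<Rightarrow> 'c" where
  "const_at ws j = snd (snd (ws ! j))"

lemma letter_at_snoc [simp]:
  "j < length ws \<Longrightarrow> letter_at (ws @ [z]) j = letter_at ws j"
  "letter_at (ws @ [(i, \<epsilon>, c)]) (length ws) = (i, \<epsilon>)"
  by (simp_all add: letter_at_def nth_append)

lemma const_at_snoc [simp]:
  "j < length ws \<Longrightarrow> const_at (ws @ [z]) j = const_at ws j"
  "const_at (ws @ [(i, \<epsilon>, c)]) (length ws) = c"
  by (simp_all add: const_at_def nth_append)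

lemma polynomial_map_entry: "polynomial_map (\<lambda>A. (D ** A ** E) $ i $ j)"
  unfolding matrix_matrix_mult_def vec_lambda_beta
  by (intro polynomial_map_sum polynomial_map.intros)

context frames
begin

section \<open>The leading coefficient of a word\<close>

definition word_poly :: "('n param \<Rightarrow> 'a) \<Rightarrow> ('a^'n^'n) cword \<Rightarrow> 'a^'n^'n" where
  "word_poly x w = foldl (\<lambda>A (i, \<epsilon>, c). A ** letter x (i, \<epsilon>) ** c) (fst w) (snd w)"

definition word_lead :: "('n param \<Rightarrow> 'a) \<Rightarrow> ('a^'n^'n) cword \<Rightarrow> 'a^'n^'n" where
  "word_lead x w = foldl (\<lambda>A (i, \<epsilon>, c). A ** outer (of_int \<epsilon> *s pvec x (i, \<epsilon>)) (qvec x (i, - \<epsilon>)) ** c)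
    (fst w) (snd w)"

lemma has_lead_word:
  "has_lead (length ws) (word_lead x (c, ws)) (\<lambda>u. word_poly (x(None := u)) (c, ws))"
proof (induction ws rule: rev_induct)
  case Nil
  show ?case by (simp add: word_lead_def word_poly_def has_lead_const)
next
  case (snoc z ws)
  obtain i \<epsilon> d where z: "z = (i, \<epsilon>, d)" by (metis prod_cases3)
  show ?case
    using has_lead_mult[OF has_lead_mult[OF snoc has_lead_letter[of "(i, \<epsilon>)" x]] has_lead_const[of d]]
    by (simp add: z word_lead_def word_poly_def del: fun_upd_apply)
qed

lemma matrix_polyfun_word: "matrix_polyfun (\<lambda>x. word_poly x (c, ws))"
proof (induction ws rule: rev_induct)
  case Nil
  show ?case by (simp add: word_poly_def matrix_polyfun_const)
next
  case (snoc z ws)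
  obtain i \<epsilon> d where z: "z = (i, \<epsilon>, d)" by (metis prod_cases3)
  show ?case
    using matrix_polyfun_mult[OF matrix_polyfun_mult[OF snoc matrix_polyfun_letter[of "(i, \<epsilon>)"]]
        matrix_polyfun_const[of d]]
    by (simp add: z word_poly_def)
qed

text \<open>The scalar that arises where the row of one letter, taken from the frame of its
  opposite, meets the column of the next letter across the constant between them.\<close>

definition lead_factor :: "('n param \<Rightarrow> 'a) \<Rightarrow> (nat \<times> int \<times> ('a^'n^'n)) list \<Rightarrow> nat \<Rightarrow> 'a" where
  "lead_factor x ws j = scalar_product (qvec x (opp (letter_at ws j)) v* const_at ws j)
    (pvec x (letter_at ws (Suc j)))"

definition lead_scalar :: "('n param \<Rightarrow> 'a) \<Rightarrow> (nat \<times> int \<times> ('a^'n^'n)) list \<Rightarrow> 'a" where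
  "lead_scalar x ws =
    (\<Prod>j<length ws. of_int (snd (letter_at ws j))) * (\<Prod>j<length ws - 1. lead_factor x ws j)"

text \<open>A product of matrices of the form column times row collapses: each inner row meets the
  next column in a scalar, and only the first column and the last row survive.\<close>

lemma word_lead_eq:
  assumes "ws \<noteq> []"
  shows "word_lead x (c, ws) = outer (lead_scalar x ws *s (c *v pvec x (letter_at ws 0)))
    (qvec x (opp (letter_at ws (length ws - 1))) v* const_at ws (length ws - 1))"
  using assms
proof (induction ws rule: rev_nonempty_induct)
  case (single z)
  obtain i \<epsilon> d where z: "z = (i, \<epsilon>, d)" by (metis prod_cases3)
  show ?case
    by (simp add: z word_lead_def lead_scalar_def letter_at_def const_at_def matrix_mult_outer
        outer_matrix_mult vector_scalar_commute)
next
  case (snoc z ws)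
  obtain i \<epsilon> d where z: "z = (i, \<epsilon>, d)" by (metis prod_cases3)
  obtain m where m: "length ws = Suc m" using snoc.hyps by (cases ws) auto
  let ?s = "lead_scalar x ws *s (c *v pvec x (letter_at ws 0))"
    and ?q = "qvec x (opp (letter_at ws m)) v* const_at ws m"
    and ?p = "pvec x (i, \<epsilon>)"
  have fac: "lead_factor x (ws @ [z]) j = lead_factor x ws j" if "j < m" for j
    using that m by (simp add: lead_factor_def)
  have last: "lead_factor x (ws @ [z]) m = scalar_product ?q ?p"
    using m letter_at_snoc(2)[of ws i \<epsilon> d] by (simp add: lead_factor_def z)
  have "lead_scalar x (ws @ [z]) = lead_scalar x ws * of_int \<epsilon> * scalar_product ?q ?p"
    using m letter_at_snoc(2)[of ws i \<epsilon> d] by (simp add: lead_scalar_def fac[unfolded z] last[unfolded z] z mult_ac)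
  moreover have "scalar_product ?q (of_int \<epsilon> *s ?p) = of_int \<epsilon> * scalar_product ?q ?p"
    by (simp add: scalar_product_def sum_distrib_left mult_ac)
  moreover have "word_lead x (c, ws @ [z])
      = outer ?s ?q ** outer (of_int \<epsilon> *s ?p) (qvec x (i, - \<epsilon>)) ** d"
    using snoc.IH m by (simp add: word_lead_def z)
  ultimately have "word_lead x (c, ws @ [z])
      = outer (lead_scalar x (ws @ [z]) *s (c *v pvec x (letter_at ws 0))) (qvec x (i, - \<epsilon>) v* d)"
    by (simp add: matrix_mult_outer outer_matrix_mult outer_mult_vector vector_smult_assoc mult_ac)
  then show ?case using m letter_at_snoc(1)[of 0 ws z] const_at_snoc(2)[of ws i \<epsilon> d] letter_at_snoc(2)[of ws i \<epsilon> d]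
    by (simp add: z)
qed

lemma polyfun_lead_factor: "(\<lambda>x. lead_factor x ws j) \<in> polyfun"
  unfolding lead_factor_def scalar_product_def vector_matrix_mult_def
  by (auto intro!: polyfun_intros polyfun_pvec polyfun_qvec)

lemma polyfun_lead_scalar: "(\<lambda>x. lead_scalar x ws) \<in> polyfun"
  unfolding lead_scalar_def
  by (intro polyfun_mult polyfun_const polyfun_prod polyfun_lead_factor)

text \<open>Each connecting factor is a polynomial in the parameters that is nonzero at some point
  over \<open>K\<close>; hence all are nonzero at a common point. The signs are units.\<close>

lemma lead_scalar_nonzero:
  assumes reduced: "reduced_word (GL_group :: ('a^'n^'n) monoid) r w"
    and nonscalar: "\<And>c a. c \<in> critical_constants w \<Longrightarrow> c \<noteq> mat a"
  shows "\<exists>\<sigma>. range \<sigma> \<subseteq> K \<and> lead_scalar \<sigma> (snd w) \<noteq> 0"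
proof -
  let ?ws = "snd w"
  have "\<exists>x\<in>slice UNIV (\<lambda>_. 0). lead_factor x ?ws j \<noteq> 0" if j: "j < length ?ws - 1" for j
  proof -
    let ?c = "const_at ?ws j"
    have c: "?c = word_const w (Suc j)" by (simp add: const_at_def word_const_def)
    have "\<exists>x. range x \<subseteq> K \<and> lead_factor x ?ws j \<noteq> 0"
    \<comment> \<open>Row and column come from the same frame exactly at the critical
      positions.\<close>
    proof (cases "letter_at ?ws (Suc j) = opp (letter_at ?ws j)")
      case True
      then have "critical w (Suc j)"
        using j by (auto simp: critical_def word_length_def word_var_def word_exp_def letter_at_def)
      then have "?c \<in> critical_constants w" unfolding critical_constants_def c by blast
      then show ?thesis
        using critical_factor[of ?c "letter_at ?ws (Suc j)"] nonscalar True by (simp add: lead_factor_def)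
    next
      case False
      have "word_const w (Suc j) \<in> carrier GL_group"
        using reduced j unfolding reduced_word_def word_length_def by simp
      then have "invertible ?c" by (simp add: c GL_group_def)
      then show ?thesis using noncritical_factor[of ?c] False by (metis lead_factor_def)
    qed
    then show ?thesis by (auto simp: slice_def)
  qed
  moreover have "range (\<lambda>_ :: 'n param. 0) \<subseteq> K" using zero_mem by auto
  ultimately obtain \<sigma> where \<sigma>: "\<sigma> \<in> slice UNIV (\<lambda>_. 0)" "(\<Prod>j<length ?ws - 1. lead_factor \<sigma> ?ws j) \<noteq> 0"
    using slice_common_nonzero_prod[of "{..<length ?ws - 1}" "\<lambda>j x. lead_factor x ?ws j" "\<lambda>_. 0" UNIV]
      polyfun_lead_factor by auto
  have "snd (letter_at ?ws j) \<in> {1, -1}" if "j < length ?ws" for j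
  proof -
    have "word_exp w (Suc j) \<in> {1, -1}"
      using reduced that unfolding reduced_word_def word_length_def by auto
    then show ?thesis by (simp add: word_exp_def letter_at_def)
  qed
  then have "of_int (snd (letter_at ?ws j)) \<noteq> (0::'a)" if "j < length ?ws" for j
    using that by fastforce
  then have "(\<Prod>j<length ?ws. of_int (snd (letter_at ?ws j)) :: 'a) \<noteq> 0" by simp
  then have "lead_scalar \<sigma> ?ws \<noteq> 0" using \<sigma>(2) by (simp add: lead_scalar_def)
  then show ?thesis using \<sigma>(1) by (intro exI[of _ \<sigma>]) (auto simp: slice_def)
qed

text \<open>\<open>letter x (i, 1)\<close> is substituted for the variable \<open>i\<close>: its
  inverse is \<open>letter x (i, -1)\<close>, and the word has only the exponents 1 and -1.\<close>

lemma word_poly_mem_word_image: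
  assumes reduced: "reduced_word (GL_group :: ('a^'n^'n) monoid) r w" and x: "range x \<subseteq> K"
  shows "word_poly x w \<in> word_image GL_group (SL K) r w"
proof -
  interpret GL: group "GL_group :: ('a^'n^'n) monoid" by (rule group_GL_group)
  define g where "g = (\<lambda>i. letter x (i, 1))"
  have inv: "letter x (i, 1) ** letter x (i, -1) = mat 1" "letter x (i, -1) ** letter x (i, 1) = mat 1" for i
    using letter_inverse[of x "(i, 1)"] letter_inverse[of x "(i, -1)"] by simp_all
  have carrier: "letter x (i, 1) \<in> carrier GL_group" "letter x (i, -1) \<in> carrier GL_group" for i
    using inv[of i] by (auto simp: GL_group_def invertible_def)
  have pow: "g i [^]\<^bsub>GL_group\<^esub> \<epsilon> = letter x (i, \<epsilon>)" if "\<epsilon> \<in> {1, -1}" for i and \<epsilon> :: int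
  proof -
    have "inv\<^bsub>GL_group\<^esub> letter x (i, 1) = letter x (i, -1)"
      using inv[of i] carrier[of i] by (intro GL.inv_equality) (simp_all add: GL_group_def)
    then show ?thesis
      using that carrier[of i] by (auto simp: g_def GL.int_pow_neg GL.int_pow_1)
  qed
  have exps: "fst (snd z) \<in> {1, -1}" if z: "z \<in> set (snd w)" for z
  proof -
    from z have "\<exists>j<length (snd w). snd w ! j = z" by (simp only: in_set_conv_nth)
    then obtain j where j: "j < length (snd w)" "snd w ! j = z" by (elim exE conjE)
    have "\<forall>j\<in>{1..length (snd w)}. word_exp w j \<in> {1, -1}"
      using reduced by (simp add: reduced_word_def word_length_def)
    then have "word_exp w (Suc j) \<in> {1, -1}" by (rule bspec) (use j(1) in simp)
    then show ?thesis by (simp only: word_exp_def diff_Suc_1 j(2))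
  qed
  have "word_value GL_group g w = word_poly x w"
    unfolding word_value_def word_poly_def
  proof (rule foldl_cong)
    fix A z assume z: "z \<in> set (snd w)"
    show "(\<lambda>(i, \<epsilon>, c). A \<otimes>\<^bsub>GL_group\<^esub> (g i [^]\<^bsub>GL_group\<^esub> \<epsilon>) \<otimes>\<^bsub>GL_group\<^esub> c) z
        = (\<lambda>(i, \<epsilon>, c). A ** letter x (i, \<epsilon>) ** c) z"
      using exps[OF z] pow by (auto simp: GL_group_def split: prod.split)
  qed simp_all
  moreover have "g i \<in> SL K" for i unfolding g_def by (rule letter_mem_SL[OF x]) simp
  ultimately show ?thesis unfolding word_image_def by (intro CollectI exI[of _ g]) simp
qed

theorem zariski_dim_word_image:
  assumes reduced: "reduced_word (GL_group :: ('a^'n^'n) monoid) r w" and nonempty: "word_length w \<ge> 1"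
    and nonscalar: "\<And>c a. c \<in> critical_constants w \<Longrightarrow> c \<noteq> mat a"
  shows "enat (2 * (CARD('n) - 1)) \<le> zariski_dim (word_image GL_group (SL K) r w)"
proof -
  obtain c ws where w: "w = (c, ws)" by fastforce
  have ws: "ws \<noteq> []" using nonempty by (auto simp: w word_length_def)
  obtain \<sigma> where \<sigma>: "range \<sigma> \<subseteq> K" "lead_scalar \<sigma> ws \<noteq> 0"
    using lead_scalar_nonzero[OF reduced nonscalar] by (auto simp: w)
  define d where "d = const_at ws (length ws - 1)"
  define y where "y = letter_at ws 0"
  define z where "z = opp (letter_at ws (length ws - 1))"
  have "word_const w 0 \<in> carrier GL_group" "word_const w (length ws) \<in> carrier GL_group"
    using reduced unfolding reduced_word_def by (simp_all add: w word_length_def)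
  then have "invertible c" "invertible d"
    using ws by (simp_all add: w d_def const_at_def word_const_def GL_group_def)
  \<comment> \<open>\<open>c'\<close> and \<open>d'\<close> strip the outer constants, which leaves
    a scalar times \<open>p q\<close> as leading coefficient.\<close>
  then obtain c' d' where c': "c' ** c = mat 1" and d': "d ** d' = mat 1"
    by (auto simp: invertible_def)
  \<comment> \<open>The entry of \<open>p q\<close> that reads off a parameter: for \<open>t\<close>
    the one at \<open>(k0, k1)\<close>, which is 1; for entries of \<open>p\<close> those in column
    \<open>k1\<close>, as \<open>q\<close> is 1 there; for entries of \<open>q\<close> those in row
    \<open>k0\<close>, as \<open>p\<close> is 1 there.\<close>
  define row where "row = (\<lambda>v :: 'n param. case v of None \<Rightarrow> k0 | Some (y, b, k) \<Rightarrow> if b then k else k0)"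
  define col where "col = (\<lambda>v :: 'n param. case v of None \<Rightarrow> k1 | Some (y, b, k) \<Rightarrow> if b then k1 else k)"
  \<comment> \<open>The released parameters are \<open>t\<close>, \<open>n - 1\<close> entries of
    the first column and \<open>n - 2\<close> entries of the last row. The Boolean tag keeps the
    latter two apart even if \<open>y = z\<close>.\<close>
  define I where "I = insert None ((\<lambda>k. Some (y, True, k)) ` (UNIV - {k0}) \<union>
    (\<lambda>k. Some (z, False, k)) ` (UNIV - {k0, k1}))"
  have "card I = Suc ((CARD('n) - 1) + (CARD('n) - 2))"
  proof -
    have "card ((\<lambda>k. Some (y, True, k)) ` (UNIV - {k0})) = CARD('n) - 1"
      by (subst card_image) (auto simp: inj_on_def card_Diff_singleton)
    moreover have "card ((\<lambda>k. Some (z, False, k)) ` (UNIV - {k0, k1})) = CARD('n) - 2"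
      using k01 by (subst card_image) (auto simp: inj_on_def card_Diff_subset)
    ultimately show ?thesis
      unfolding I_def by (subst card_insert_disjoint) (auto, subst card_Un_disjoint, auto)
  qed
  moreover have "CARD('n) \<ge> 2"
    using card_mono[of UNIV "{k0, k1}"] k01 by simp
  ultimately have card_I: "card I = 2 * (CARD('n) - 1)" by simp
  have "enat (card I) \<le> zariski_dim (word_image GL_group (SL K) r w)"
  proof (rule zariski_dim_ge_if_leading_forms[where I = I and t = None and \<sigma> = \<sigma> and l = "length ws"
        and \<phi> = "\<lambda>x. word_poly x w" and F = "\<lambda>v A. (c' ** A ** d') $ row v $ col v"
        and \<kappa> = "\<lambda>x. lead_scalar x ws"])
    show "finite I" "None \<in> I" by (simp_all add: I_def)
    show "(\<lambda>x. word_poly x w $ i $ j) \<in> polyfun" for i j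
      using matrix_polyfun_word[of c ws] by (simp add: w matrix_polyfun_def)
    show "polynomial_map (\<lambda>A. (c' ** A ** d') $ row v $ col v)" for v by (rule polynomial_map_entry)
    fix v x assume v: "v \<in> I"
    have "has_lead (0 + length ws + 0) (c' ** word_lead x w ** d') (\<lambda>u. c' ** word_poly (x(None := u)) w ** d')"
      unfolding w by (intro has_lead_mult has_lead_const has_lead_word)
    moreover have "c' ** word_lead x w ** d' = outer (lead_scalar x ws *s pvec x y) (qvec x z)"
      unfolding w word_lead_eq[OF ws] d_def[symmetric] y_def[symmetric] z_def[symmetric]
      by (simp add: matrix_mult_outer outer_matrix_mult vector_scalar_commute
          matrix_vector_mul_assoc vector_matrix_mul_assoc c' d')
    moreover have "outer (lead_scalar x ws *s pvec x y) (qvec x z) $ row v $ col v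
        = lead_scalar x ws * (if v = None then 1 else x v)"
      using v k01 by (auto simp: I_def outer_def row_def col_def pvec_def qvec_nth rvec_def)
    ultimately show "\<exists>P. degree P \<le> length ws \<and> coeff P (length ws) = lead_scalar x ws * (if v = None then 1 else x v) \<and>
        (\<forall>u. poly P u = (c' ** word_poly (x(None := u)) w ** d') $ row v $ col v)"
      unfolding has_lead_def by (metis add.right_neutral add_0)
  qed (use ws \<sigma> polyfun_lead_scalar word_poly_mem_word_image[OF reduced] in auto)
  then show ?thesis by (simp add: card_I)
qed

end


section \<open>Scalar matrices are Tomanov-small\<close>

lemma mat_commute: "mat a ** A = A ** mat (a :: 'a::field)"
  by (simp add: matrix_matrix_mult_def mat_def vec_eq_iff mult.commute
      if_distrib[of "\<lambda>x. x * _"] if_distrib[of "\<lambda>x. _ * x"] cong: if_cong)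

lemma vector_mult_mat: "v v* mat a = a *s (v :: 'a::field^'n)"
  by (simp add: vector_matrix_mult_def mat_def vec_eq_iff mult.commute
      if_distrib[of "\<lambda>x. x * _"] if_distrib[of "\<lambda>x. _ * x"] cong: if_cong)

text \<open>A scalar matrix is unchanged by conjugation and takes \<open>e 1\<close> to a multiple
  of itself. The coordinate of that multiple at the last basis vector vanishes, since for
  \<open>n \<ge> 2\<close> the last vector is not the first.\<close>

lemma scalar_tomanov_small:
  fixes e :: "nat \<Rightarrow> 'a::field^'n" and a :: 'a
  assumes n: "CARD('n) \<ge> 2" and e: "weight_basis T e"
    and a: "(mat a :: 'a^'n^'n) \<in> carrier GL_group"
  shows "(mat a :: 'a^'n^'n) \<in> tomanov_small (SL UNIV) e"
  unfolding tomanov_small_def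
proof (intro CollectI conjI ballI)
  show "(mat a :: 'a^'n^'n) \<in> carrier GL_group" by (rule a)
  fix g :: "'a^'n^'n" assume "g \<in> SL UNIV"
  then have g: "g \<in> carrier GL_group" by (simp add: SL_def GL_group_def invertible_det_nz)
  interpret GL: group "GL_group :: ('a^'n^'n) monoid" by (rule group_GL_group)
  have "inv\<^bsub>GL_group\<^esub> g \<otimes>\<^bsub>GL_group\<^esub> mat a \<otimes>\<^bsub>GL_group\<^esub> g = inv\<^bsub>GL_group\<^esub> g ** g ** mat a"
    by (simp add: GL_group_def matrix_mul_assoc[symmetric] mat_commute)
  also have "\<dots> = mat a" using GL.l_inv[OF g] by (simp add: GL_group_def)
  finally have "e 1 v* (inv\<^bsub>GL_group\<^esub> g \<otimes>\<^bsub>GL_group\<^esub> mat a \<otimes>\<^bsub>GL_group\<^esub> g) = a *s e 1"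
    by (simp add: vector_mult_mat)
  moreover have "dual_basis e CARD('n) (a *s e 1) = 0"
  proof -
    let ?B = "e ` {1..CARD('n)}"
    have B: "vec.independent ?B" "vec.span ?B = UNIV" "inj_on e {1..CARD('n)}"
      using e by (simp_all add: weight_basis_def)
    have "e CARD('n) \<noteq> e 1" using inj_onD[OF B(3), of "CARD('n)" 1] n by auto
    moreover have "e 1 \<in> ?B" using n by auto
    ultimately show ?thesis
      using B by (simp add: dual_basis_def vec.representation_scale vec.representation_basis)
  qed
  ultimately show "dual_basis e CARD('n)
      (e 1 v* (inv\<^bsub>GL_group\<^esub> g \<otimes>\<^bsub>GL_group\<^esub> mat a \<otimes>\<^bsub>GL_group\<^esub> g)) = 0" by simp
qed

section \<open>From subfields and Tomanov-small constants to frames\<close>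

lemma infinite_subring_subfield:
  fixes K :: "'a::field set"
  assumes "subfield K (ring_of_type_algebra :: 'a ring)" "infinite K"
  shows "infinite_subring K"
proof -
  interpret R: ring "ring_of_type_algebra :: 'a ring" by (rule ring_from_type_algebra)
  have sub: "subring K (ring_of_type_algebra :: 'a ring)" using assms(1) by (rule subfieldE(1))
  have "\<ominus>\<^bsub>ring_of_type_algebra\<^esub> x = - x" for x :: 'a
    by (rule R.minus_equality) (simp_all add: ring_of_type_algebra_def)
  then show ?thesis
    using subringE[OF sub] assms(2)
    by unfold_locales (auto simp: ring_of_type_algebra_def)
qed

theorem theorem19:
  fixes L K :: "'a::field set" and \<tau> :: "'a topology"
    and T :: "('a^'n^'n) set" and e :: "nat \<Rightarrow> 'a^'n"
    and r :: nat and w :: "('a^'n^'n) cword"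
  assumes "CARD('n) \<ge> 2"
    and "local_field L \<tau>"
    and "algebraic_closure (ring_of_type_algebra :: 'a ring) L"
    and "subfield K (ring_of_type_algebra :: 'a ring)" and "K \<subseteq> L" and "infinite K"
    and "maximal_torus (SL UNIV) T" and "weight_basis T e"
    and "highest_lowest (SL UNIV) T (e 1) (e CARD('n))"
    and "r \<ge> 1" and "reduced_word GL_group r w" and "word_length w \<ge> 2"
    and "tomanov_small (SL UNIV) e \<inter> critical_constants w = {}"
  shows "zariski_dim (word_image GL_group (SL K) r w) \<ge> enat (2 * (CARD('n) - 1))"
proof -
  interpret infinite_subring K using infinite_subring_subfield assms(4,6) by blast
  obtain k0 k1 :: 'n where "k0 \<noteq> k1"
    using assms(1) card_le_Suc0_iff_eq[of "UNIV :: 'n set"] by (auto simp: not_le[symmetric])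
  then interpret frames K k0 k1 by unfold_locales
  show ?thesis
  proof (rule zariski_dim_word_image[OF assms(11)])
    show "1 \<le> word_length w" using assms(12) by simp
    fix c and a :: 'a assume c: "c \<in> critical_constants w"
    then have "c \<in> carrier GL_group"
      using assms(11) by (auto simp: critical_constants_def critical_def reduced_word_def)
    \<comment> \<open>A scalar \<open>c\<close> would be Tomanov-small, being invertible, and could
      not be critical.\<close>
    then show "c \<noteq> mat a" using scalar_tomanov_small[OF assms(1,8)] assms(13) c by blast
  qed
qed

end
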